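(* Let $s>0$, let $C\subset\mathbb R^d$ be a compact $s$-regular set and let $\{\varphi_i\}_{i=1}^{\kappa}$ be a similitude iterated function system on $\mathbb R^d$ satisfying the condensation open set condition with condensation $C$. Let $E$ be the associated self-similar set, let $E_C$ be the inhomogeneous self-similar set with condensation $C$, and suppose that $\underline{\dim}_{\mathrm A}(E)<s$. Then for $\mu=\mathcal H^{s}|_{E_C}$, the restriction of the $s$-dimensional Hausdorff measure to $E_C$, it holds that $$\underline{\dim}_{\mathrm{reg}}(\mu)=s=\underline{\dim}_{\mathrm A}(E_C).$$
   Context: A similitude iterated function system (IFS) is a finite collection $\{\varphi_i\}_{i=1}^\kappa$ of contractive similitudes of $\mathbb R^d$. The associated self-similar set is the unique nonempty compact set $E\subset\mathbb R^d$ with $E=\bigcup_{i=1}^\kappa\varphi_i(E)$. For a compact set $C\subset\mathbb R^d$, the inhomogeneous self-similar set with condensation $C$ is the unique nonempty compact set $E_C\subset\mathbb R^d$ with $E_C=\bigcup_{i=1}^\kappa\varphi_i(E_C)\cup C$. Condensation open set condition (COSC) with condensation $C$: there exists a nonempty open set $U\subset\mathbb R^d$ such that $C\subset U\setminus\bigcup_i\overline{\varphi_i(U)}$, $\varphi_i(U)\subset U$ for all $i$, and $\varphi_i(U)\cap\varphi_j(U)=\emptyset$ whenever $i\ne j$. Measure on a metric space: a nontrivial Borel regular outer measure for which bounded sets have finite measure. Balls $B(x,r)$ are closed, and subsets of $\mathbb R^d$ are regarded as metric spaces with the restricted metric. $s$-regular set: a set $A\subset\mathbb R^d$ with at least two points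 is $s$-regular ($s>0$) if there are a measure $\nu$ on the metric space $A$ and a constant $c\ge1$ such that $c^{-1}r^s\le\nu(B(x,r))\le c\,r^s$ for all $x\in A$ and $0<r<\operatorname{diam}(A)$. Lower dimension $\underline{\dim}_{\mathrm A}(A)$ of a set $A\subset\mathbb R^d$: the supremum of all $t\ge0$ for which there is a constant $c>0$ such that, for all $x\in A$ and $0<r<R<\operatorname{diam}(A)$, at least $c(r/R)^{-t}$ balls of radius $r$ are needed to cover the closed ball $B(x,R)$ of $A$. (For a one-point set the restriction $R<\operatorname{diam}(A)$ is removed.) Lower regularity dimension $\underline{\dim}_{\mathrm{reg}}(\mu)$ of a measure $\mu$ on a metric space $X$ (here $X=E_C$): the supremum of all $t\ge0$ for which there is a constant $c\ge1$ such that $\frac{\mu(B(x,r))}{\mu(B(x,R))}\le c\left(\frac rR\right)^t$ whenever $x\in X$ and $0<r<R<\operatorname{diam}(X)$. *)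

theory Defs
  imports "HOL-Analysis.Analysis"
begin

section \<open>Diameter and measures on metric spaces\<close>

text \<open>
  The library's \<^const>\<open>diameter\<close> is real-valued and unspecified on unbounded sets; here the
  diameter of an unbounded set is infinite.
\<close>

definition ediam :: "'a::metric_space set \<Rightarrow> ennreal" where
  "ediam A = (SUP (x, y)\<in>A \<times> A. ennreal (dist x y))"

text \<open>
  A measure on the metric space \<open>X\<close> (a subset of an ambient space with the restricted metric) is a
  nontrivial Borel regular outer measure on \<open>X\<close> that is finite on bounded sets. It is represented by
  a function of which only the values on subsets of \<open>X\<close> matter. The conjunct with
  \<^const>\<open>lambda_system\<close> says that the Borel sets of \<open>X\<close> are Caratheodory measurable. The library's
  countable subadditivity speaks about disjoint families only; with monotonicity on the power set
  this is the usual countable subadditivity.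
\<close>

definition metric_measure :: "'a::metric_space set \<Rightarrow> ('a set \<Rightarrow> ennreal) \<Rightarrow> bool" where
  "metric_measure X \<mu> \<longleftrightarrow>
     outer_measure_space (Pow X) \<mu> \<and>
     sets (restrict_space borel X) \<subseteq> lambda_system X (Pow X) \<mu> \<and>
     (\<forall>A\<subseteq>X. \<exists>B\<in>sets (restrict_space borel X). A \<subseteq> B \<and> \<mu> B = \<mu> A) \<and>
     \<mu> X \<noteq> 0 \<and>
     (\<forall>A\<subseteq>X. bounded A \<longrightarrow> \<mu> A < \<infinity>)"

text \<open>
  In the metric space \<open>X\<close> the closed ball of center \<open>x \<in> X\<close> and radius \<open>r\<close> is \<open>cball x r \<inter> X\<close>.
\<close>

definition s_regular :: "real \<Rightarrow> 'a::metric_space set \<Rightarrow> bool" where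
  "s_regular s A \<longleftrightarrow>
     s > 0 \<and> (\<exists>x\<in>A. \<exists>y\<in>A. x \<noteq> y) \<and>
     (\<exists>\<nu> c. metric_measure A \<nu> \<and> c \<ge> 1 \<and>
        (\<forall>x\<in>A. \<forall>r. 0 < r \<and> ennreal r < ediam A \<longrightarrow>
           ennreal (r powr s / c) \<le> \<nu> (cball x r \<inter> A) \<and>
           \<nu> (cball x r \<inter> A) \<le> ennreal (c * r powr s)))"

section \<open>Hausdorff measure\<close>

text \<open>
  The unnormalised Hausdorff (outer) measure, for \<open>s > 0\<close>. The covering sets are required to be
  bounded since \<^const>\<open>diameter\<close> is only meaningful then; \<open>0 powr s = 0\<close>, so empty covering sets
  contribute nothing.
\<close>

definition hausdorff_pre :: "real \<Rightarrow> real \<Rightarrow> 'a::metric_space set \<Rightarrow> ennreal" where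
  "hausdorff_pre s \<delta> A =
     (INF U\<in>{U :: nat \<Rightarrow> 'a set. A \<subseteq> (\<Union>i. U i) \<and> (\<forall>i. bounded (U i) \<and> diameter (U i) \<le> \<delta>)}.
        \<Sum>i. ennreal (diameter (U i) powr s))"

definition hausdorff_measure :: "real \<Rightarrow> 'a::metric_space set \<Rightarrow> ennreal" where
  "hausdorff_measure s A = (SUP \<delta>\<in>{0<..}. hausdorff_pre s \<delta> A)"

section \<open>Dimensions\<close>

text \<open>
  ``At least \<open>N\<close> balls are needed'' is expressed by: every finite cover by balls centered in \<open>A\<close> has
  at least \<open>N\<close> members. For a one-point set the bound \<open>R < diam A\<close> is dropped.
\<close>

definition lower_dim :: "'a::metric_space set \<Rightarrow> ereal" where
  "lower_dim A = (SUP t\<in>{t::real. t \<ge> 0 \<and>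
     (\<exists>c>0. \<forall>x\<in>A. \<forall>r R.
        0 < r \<and> r < R \<and> (ennreal R < ediam A \<or> (\<exists>a. A = {a})) \<longrightarrow>
        (\<forall>F\<subseteq>A. finite F \<and> cball x R \<inter> A \<subseteq> (\<Union>y\<in>F. cball y r \<inter> A) \<longrightarrow>
           c * (r / R) powr (- t) \<le> real (card F)))}. ereal t)"

definition lower_reg_dim :: "'a::metric_space set \<Rightarrow> ('a set \<Rightarrow> ennreal) \<Rightarrow> ereal" where
  "lower_reg_dim X \<mu> = (SUP t\<in>{t::real. t \<ge> 0 \<and>
     (\<exists>c\<ge>1. \<forall>x\<in>X. \<forall>r R.
        0 < r \<and> r < R \<and> ennreal R < ediam X \<longrightarrow>
        \<mu> (cball x r \<inter> X) / \<mu> (cball x R \<inter> X) \<le> ennreal (c * (r / R) powr t))}. ereal t)"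

section \<open>Similitude iterated function systems\<close>

definition contractive_similitude :: "('a::metric_space \<Rightarrow> 'a) \<Rightarrow> bool" where
  "contractive_similitude f \<longleftrightarrow>
     (\<exists>\<rho>. 0 < \<rho> \<and> \<rho> < 1 \<and> (\<forall>x y. dist (f x) (f y) = \<rho> * dist x y))"

definition similitude_ifs :: "nat \<Rightarrow> (nat \<Rightarrow> 'a::metric_space \<Rightarrow> 'a) \<Rightarrow> bool" where
  "similitude_ifs \<kappa> \<phi> \<longleftrightarrow> \<kappa> \<ge> 1 \<and> (\<forall>i\<in>{1..\<kappa>}. contractive_similitude (\<phi> i))"

text \<open>
  For an iterated function system on a Euclidean space (and compact \<open>C\<close>), each of the following two
  predicates is satisfied by exactly one set.
\<close>

definition self_similar_set ::
    "nat \<Rightarrow> (nat \<Rightarrow> 'a::metric_space \<Rightarrow> 'a) \<Rightarrow> 'a set \<Rightarrow> bool" where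
  "self_similar_set \<kappa> \<phi> E \<longleftrightarrow> E \<noteq> {} \<and> compact E \<and> E = (\<Union>i\<in>{1..\<kappa>}. \<phi> i ` E)"

definition inhomogeneous_self_similar_set ::
    "nat \<Rightarrow> (nat \<Rightarrow> 'a::metric_space \<Rightarrow> 'a) \<Rightarrow> 'a set \<Rightarrow> 'a set \<Rightarrow> bool" where
  "inhomogeneous_self_similar_set \<kappa> \<phi> C EC \<longleftrightarrow>
     EC \<noteq> {} \<and> compact EC \<and> EC = (\<Union>i\<in>{1..\<kappa>}. \<phi> i ` EC) \<union> C"

definition condensation_open_set_condition ::
    "nat \<Rightarrow> (nat \<Rightarrow> 'a::metric_space \<Rightarrow> 'a) \<Rightarrow> 'a set \<Rightarrow> bool" where
  "condensation_open_set_condition \<kappa> \<phi> C \<longleftrightarrow>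
     (\<exists>U. U \<noteq> {} \<and> open U \<and>
        C \<subseteq> U - (\<Union>i\<in>{1..\<kappa>}. closure (\<phi> i ` U)) \<and>
        (\<forall>i\<in>{1..\<kappa>}. \<phi> i ` U \<subseteq> U) \<and>
        (\<forall>i\<in>{1..\<kappa>}. \<forall>j\<in>{1..\<kappa>}. i \<noteq> j \<longrightarrow> \<phi> i ` U \<inter> \<phi> j ` U = {}))"

end

theory Submission
  imports Defs
begin

text \<open>
  The hypothesis on \<open>E\<close> is used only to obtain \<open>\<Sum>i. \<rho> i powr s < 1\<close> for the contraction ratios
  \<open>\<rho> i\<close>: otherwise there are at least \<open>\<delta> powr (-s)\<close> disjoint pieces of size about \<open>\<delta>\<close>, of which each ball
  of radius \<open>\<delta>\<close> meets only boundedly many by a volume count, so that the lower dimension of \<open>E\<close> is at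
  least \<open>s\<close>. Given the inequality, the restriction of the Hausdorff measure to \<open>EC\<close> is finite and in
  fact \<open>s\<close>-Ahlfors regular. Since \<open>C\<close> is \<open>s\<close>-regular, this holds near each copy of \<open>C\<close>, the copies
  of \<open>C\<close> are separated by a fixed proportion of their size, and all smaller copies near a given ball are
  controlled by the same volume count. Both dimensions of an \<open>s\<close>-Ahlfors regular measure space equal \<open>s\<close>.
\<close>

section \<open>Metric outer measures\<close>

text \<open>A point of \<open>EC\<close> may lie in no copy of \<open>C\<close>, and a copy of
  \<open>C\<close> that meets a ball may be far larger than the ball. Words stopped at a scale
  \<open>\<delta>\<close> sort this out: each point of \<open>EC\<close> lies in a copy of
  \<open>EC\<close> with ratio comparable to \<open>\<delta>\<close> or in a copy of
  \<open>C\<close> with ratio above \<open>\<delta>\<close>. For the lower mass bound, a copy of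
  \<open>EC\<close> inside the ball already brings along a whole copy of \<open>C\<close>.

  The volume count places a small ball in each of the disjoint copies of \<open>U\<close> and
  compares Lebesgue measures. It needs copies of bounded size, so \<open>U\<close> is first
  intersected with a large ball that all maps send into itself.

  The lower dimension of \<open>E\<close> speaks about small balls of \<open>E\<close>. Each
  contains a comparable piece of \<open>E\<close>, which the inverse of its word map blows up to
  \<open>E\<close>, so covers of all of \<open>E\<close> are the only ones to be counted.

  The strict inequality for the ratios makes the mass finite: the copies of \<open>C\<close> under
  words of length \<open>n\<close> have total mass \<open>(\<Sum>i. \<rho> i powr s) ^ n\<close>
  times that of \<open>C\<close>. The formal argument reads finiteness off the equation for
  \<open>EC\<close>, without splitting \<open>EC\<close> into \<open>E\<close> and the copies of
  \<open>C\<close>.\<close>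

lemma finite_subadditive_of_countable:
  fixes h :: "'a set \<Rightarrow> ennreal"
  assumes "h {} = 0" and csub: "\<And>S :: nat \<Rightarrow> 'a set. (\<And>i. S i \<subseteq> X) \<Longrightarrow> h (\<Union>i. S i) \<le> (\<Sum>i. h (S i))"
    and "finite I" and sub: "\<And>i. i \<in> I \<Longrightarrow> A i \<subseteq> X"
  shows "h (\<Union>i\<in>I. A i) \<le> (\<Sum>i\<in>I. h (A i))"
proof -
  obtain f n where f: "bij_betw f {..<n::nat} I"
    using \<open>finite I\<close> ex_bij_betw_nat_finite by (metis atLeast0LessThan)
  let ?B = "\<lambda>i. if i < n then A (f i) else {}"
  have "(\<Union>i\<in>I. A i) = (\<Union>i. ?B i)"
    using f by (auto simp: bij_betw_def split: if_splits)
  moreover have "?B i \<subseteq> X" for i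
    using f sub by (auto simp: bij_betw_def)
  ultimately have "h (\<Union>i\<in>I. A i) \<le> (\<Sum>i. h (?B i))"
    using csub[of ?B] by simp
  also have "\<dots> = (\<Sum>i<n. h (?B i))"
    by (rule suminf_finite) (auto simp: \<open>h {} = 0\<close>)
  also have "\<dots> = (\<Sum>i<n. h (A (f i)))" by simp
  also have "\<dots> = (\<Sum>i\<in>I. h (A i))"
    by (rule sum.reindex_bij_betw[OF f])
  finally show ?thesis .
qed

text \<open>The setting of Caratheodory's criterion: additivity on sets at positive distance.
  \<open>h_separated\<close> asks only for the inequality that subadditivity does not give.\<close>

locale metric_outer_measure =
  fixes h :: "'a::metric_space set \<Rightarrow> ennreal"
  assumes h_empty: "h {} = 0"
    and h_mono: "A \<subseteq> B \<Longrightarrow> h A \<le> h B"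
    and h_countable_subadditive: "h (\<Union>i::nat. S i) \<le> (\<Sum>i. h (S i))"
    and h_separated: "0 < d \<Longrightarrow> (\<And>x y. x \<in> A \<Longrightarrow> y \<in> B \<Longrightarrow> d \<le> dist x y) \<Longrightarrow> h A + h B \<le> h (A \<union> B)"
begin

lemma h_finite_UN: "finite I \<Longrightarrow> h (\<Union>i\<in>I. A i) \<le> (\<Sum>i\<in>I. h (A i))"
  by (rule finite_subadditive_of_countable[where X = UNIV]) (auto intro: h_empty h_countable_subadditive)

lemma h_Un: "h (A \<union> B) \<le> h A + h B"
proof -
  have "h (\<Union>i\<in>{True, False}. if i then A else B) \<le> (\<Sum>i\<in>{True, False}. h (if i then A else B))"
    by (rule h_finite_UN) simp
  then show ?thesis by (simp add: Un_commute)
qed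

text \<open>
  The sets \<open>R\<close> are the parts of \<open>A - F\<close> between consecutive distances to \<open>F\<close>. Those with indices of
  the same parity are pairwise separated, so their values sum up to at most \<open>h A\<close>.
\<close>
lemma closed_split:
  assumes "closed F"
  shows "h (F \<inter> A) + h (A - F) \<le> h A"
proof (cases "F = {} \<or> h A = top")
  case True
  then show ?thesis by (auto simp: h_empty)
next
  case False
  then have ne: "F \<noteq> {}" and fin: "h A \<noteq> top" by auto
  define B where "B n = {x \<in> A - F. 1 / real (Suc n) \<le> infdist x F}" for n
  define R where "R n = B (Suc n) - B n" for n
  have B_mono: "B m \<subseteq> B n" if "m \<le> n" for m n
  proof -
    have "1 / real (Suc n) \<le> 1 / real (Suc m)"
      using that by (intro divide_left_mono) auto
    then show ?thesis by (auto simp: B_def)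
  qed
  have B_UN: "A - F = (\<Union>n. B n)"
  proof -
    have "\<exists>n. x \<in> B n" if "x \<in> A - F" for x
    proof -
      have "infdist x F > 0"
        using that ne assms in_closed_iff_infdist_zero[of F x] infdist_nonneg[of x F] by force
      then obtain n where "1 / real (Suc n) < infdist x F"
        using nat_approx_posE by blast
      then show ?thesis using that by (auto simp: B_def intro!: exI[of _ n])
    qed
    then show ?thesis by (auto simp: B_def)
  qed
  have inf_R: "x \<in> A - F" "1 / real (n + 2) \<le> infdist x F" "infdist x F < 1 / real (Suc n)"
    if "x \<in> R n" for x n
    using that by (auto simp: R_def B_def)
  have parity: "(\<Sum>k<n. h (R (2 * k + p))) \<le> h (\<Union>k<n. R (2 * k + p))" for n p
  proof (induction n)
    case 0
    then show ?case by (simp add: h_empty)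
  next
    case (Suc n)
    \<comment> \<open>Points of \<open>R (2 * k + p)\<close> with \<open>k < n\<close> have distance
      at least \<open>1 / (2 * n + p)\<close> from \<open>F\<close>, points of
      \<open>R (2 * n + p)\<close> less than \<open>1 / Suc (2 * n + p)\<close>; \<open>d\<close> is
      the gap. For \<open>n = p = 0\<close> it is negative because \<open>1 / 0 = 0\<close>, hence
      the separate case \<open>n = 0\<close>.\<close>
    define d where "d = 1 / real (2 * n + p) - 1 / real (Suc (2 * n + p))"
    have "h (\<Union>k<n. R (2 * k + p)) + h (R (2 * n + p)) \<le> h ((\<Union>k<n. R (2 * k + p)) \<union> R (2 * n + p))"
    proof (cases "n = 0")
      case True
      then show ?thesis by (simp add: h_empty)
    next
      case False
      show ?thesis
      proof (rule h_separated[of d])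
        show "0 < d" using False unfolding d_def
          by (intro diff_gt_0_iff_gt[THEN iffD2] divide_strict_left_mono) auto
        fix x y assume "x \<in> (\<Union>k<n. R (2 * k + p))" and y: "y \<in> R (2 * n + p)"
        then obtain k where k: "k < n" "x \<in> R (2 * k + p)" by auto
        have "1 / real (2 * n + p) \<le> 1 / real (2 * k + p + 2)"
          using k by (intro divide_left_mono) auto
        then have "d \<le> infdist x F - infdist y F"
          using inf_R(2)[OF k(2)] inf_R(3)[OF y] by (simp add: d_def)
        also have "\<dots> \<le> dist x y" using infdist_triangle[of x F y] by simp
        finally show "d \<le> dist x y" .
      qed
    qed
    moreover have "(\<Union>k<Suc n. R (2 * k + p)) = (\<Union>k<n. R (2 * k + p)) \<union> R (2 * n + p)"
      by (auto simp: less_Suc_eq)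
    ultimately show ?case
      using order_trans[OF add_right_mono[OF Suc]] by simp
  qed
  have sum_parity: "(\<Sum>k<n. h (R (2 * k + p))) \<le> h A" for n p
  proof -
    have "(\<Union>k<n. R (2 * k + p)) \<subseteq> A" using inf_R(1) by blast
    then show ?thesis using parity[where n=n and p=p] h_mono order_trans by blast
  qed
  have sum_R: "(\<Sum>k<n. h (R k)) \<le> 2 * h A" for n
  proof -
    have "(\<Sum>k<n. h (R k)) \<le> (\<Sum>k<2*n. h (R k))" by (rule sum_mono2) auto
    also have "\<dots> = (\<Sum>k<n. h (R (2 * k + 0))) + (\<Sum>k<n. h (R (2 * k + 1)))"
      by (induction n) (auto simp: algebra_simps)
    also have "\<dots> \<le> h A + h A" by (intro add_mono sum_parity)
    finally show ?thesis by (simp add: mult_2)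
  qed
  then have "(\<Sum>k. h (R k)) \<le> 2 * h A"
    by (simp add: suminf_eq_SUP SUP_least)
  then have suminf_R: "(\<Sum>k. h (R k)) \<noteq> top"
    using fin by (auto simp: top_unique ennreal_mult_eq_top_iff)
  have F_B: "h (F \<inter> A) + h (B n) \<le> h A" for n
  proof -
    have "h (F \<inter> A) + h (B n) \<le> h ((F \<inter> A) \<union> B n)"
    proof (rule h_separated[of "1 / real (Suc n)"])
      fix x y assume "x \<in> F \<inter> A" "y \<in> B n"
      then show "1 / real (Suc n) \<le> dist x y"
        using infdist_le[of x F y] by (auto simp: B_def dist_commute)
    qed simp
    also have "\<dots> \<le> h A" by (rule h_mono) (auto simp: B_def)
    finally show ?thesis .
  qed
  have tail: "A - F \<subseteq> B n \<union> (\<Union>k. R (k + n))" for n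
  proof
    fix x assume "x \<in> A - F"
    then obtain m where m: "x \<in> B m" using B_UN by auto
    define l where "l = (LEAST l. x \<in> B l)"
    have l: "x \<in> B l" "\<And>j. j < l \<Longrightarrow> x \<notin> B j"
      unfolding l_def using m by (auto intro: LeastI dest: not_less_Least)
    show "x \<in> B n \<union> (\<Union>k. R (k + n))"
    proof (cases "l \<le> n")
      case True
      then show ?thesis using l B_mono by blast
    next
      case False
      then have "x \<in> R (l - 1 - n + n)" using l by (simp add: R_def)
      then show ?thesis by blast
    qed
  qed
  \<comment> \<open>Adding the partial sum completes the tail left over by \<open>B n\<close> to the
    whole series, so the bound no longer depends on \<open>n\<close>. The value of the series is
    finite and is cancelled at the end.\<close>
  have step: "(h (F \<inter> A) + h (A - F)) + (\<Sum>k<n. h (R k)) \<le> h A + (\<Sum>k. h (R k))" for n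
  proof -
    have "h (A - F) \<le> h (B n) + (\<Sum>k. h (R (k + n)))"
      using h_mono[OF tail[of n]] h_Un[of "B n" "\<Union>k. R (k + n)"]
        h_countable_subadditive[of "\<lambda>k. R (k + n)"]
      by (meson add_left_mono order_trans)
    then have "(h (F \<inter> A) + h (A - F)) + (\<Sum>k<n. h (R k))
        \<le> (h (F \<inter> A) + (h (B n) + (\<Sum>k. h (R (k + n))))) + (\<Sum>k<n. h (R k))"
      by (intro add_mono) auto
    also have "\<dots> = (h (F \<inter> A) + h (B n)) + ((\<Sum>k. h (R (k + n))) + (\<Sum>k<n. h (R k)))"
      by (simp add: ac_simps)
    also have "(\<Sum>k. h (R (k + n))) + (\<Sum>k<n. h (R k)) = (\<Sum>k. h (R k))"
      by (subst suminf_offset[of "\<lambda>k. h (R k)" n]) auto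
    finally show ?thesis using F_B add_right_mono order_trans by blast
  qed
  have "(\<Sum>k. h (R k)) + (h (F \<inter> A) + h (A - F)) \<le> h A + (\<Sum>k. h (R k))"
    by (rule ennreal_suminf_bound_add) (use step in \<open>simp add: ac_simps\<close>)
  then have "(\<Sum>k. h (R k)) + (h (F \<inter> A) + h (A - F)) \<le> (\<Sum>k. h (R k)) + h A"
    by (simp add: ac_simps)
  then show ?thesis
    using suminf_R by (simp only: ennreal_add_left_cancel_le) auto
qed

lemma outer_measure_space_UNIV: "outer_measure_space (Pow UNIV) h"
  unfolding outer_measure_space_def positive_def increasing_def countably_subadditive_def
  using h_empty h_mono h_countable_subadditive by auto

text \<open>The Caratheodory measurable sets form a sigma-algebra; it contains the closed sets by
  \<open>closed_split\<close>, and these generate the Borel sets.\<close>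

lemma borel_split:
  assumes "B \<in> sets borel"
  shows "h (B \<inter> A) + h (A - B) = h A"
proof -
  have sa: "sigma_algebra (UNIV :: 'a set) (Pow UNIV)" by (rule sigma_algebra_Pow)
  have "measure_space UNIV (lambda_system UNIV (Pow UNIV) h) h"
    using sigma_algebra.caratheodory_lemma[OF sa outer_measure_space_UNIV] .
  then interpret L: sigma_algebra UNIV "lambda_system UNIV (Pow UNIV) h"
    by (simp add: measure_space_def)
  have "F \<in> lambda_system UNIV (Pow UNIV) h" if "closed F" for F
  proof -
    have "h (F \<inter> A) + h ((UNIV - F) \<inter> A) = h A" for A
    proof (rule antisym)
      have "(UNIV - F) \<inter> A = A - F" by auto
      then show "h (F \<inter> A) + h ((UNIV - F) \<inter> A) \<le> h A" using closed_split[OF that] by simp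
      have "h ((F \<inter> A) \<union> ((UNIV - F) \<inter> A)) \<le> h (F \<inter> A) + h ((UNIV - F) \<inter> A)" by (rule h_Un)
      moreover have "(F \<inter> A) \<union> ((UNIV - F) \<inter> A) = A" by auto
      ultimately show "h A \<le> h (F \<inter> A) + h ((UNIV - F) \<inter> A)" by simp
    qed
    then show ?thesis by (simp add: lambda_system_def)
  qed
  then have "sigma_sets UNIV (Collect closed) \<subseteq> lambda_system UNIV (Pow UNIV) h"
    by (intro L.sigma_sets_subset) auto
  then have "B \<in> lambda_system UNIV (Pow UNIV) h"
    using assms by (auto simp: borel_eq_closed)
  moreover have "(UNIV - B) \<inter> A = A - B" by auto
  ultimately show ?thesis unfolding lambda_system_def by (metis (mono_tags, lifting) Pow_UNIV UNIV_I mem_Collect_eq)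
qed

text \<open>A relatively Borel set \<open>X \<inter> B'\<close> cuts a subset of \<open>X\<close>
  exactly as \<open>B'\<close> does, so measurability passes from the whole space to
  \<open>X\<close>. A Borel hull of \<open>A \<subseteq> X\<close> intersected with \<open>X\<close>
  lies between \<open>A\<close> and the hull, hence has the same value.\<close>

lemma metric_measure_restrict:
  assumes reg: "\<And>A. \<exists>B\<in>sets borel. A \<subseteq> B \<and> h B = h A"
    and "h X \<noteq> 0" "h X < \<infinity>"
  shows "metric_measure X (\<lambda>A. h (A \<inter> X))"
  unfolding metric_measure_def
proof (intro conjI allI impI)
  show "outer_measure_space (Pow X) (\<lambda>A. h (A \<inter> X))"
    unfolding outer_measure_space_def positive_def increasing_def countably_subadditive_def
  proof (intro conjI allI ballI impI)
    fix A :: "nat \<Rightarrow> 'a set"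
    show "h ((\<Union>i. A i) \<inter> X) \<le> (\<Sum>i. h (A i \<inter> X))"
      using h_countable_subadditive[of "\<lambda>i. A i \<inter> X"] by (simp add: Int_commute)
  qed (auto intro: h_mono simp: h_empty)
  show "sets (restrict_space borel X) \<subseteq> lambda_system X (Pow X) (\<lambda>A. h (A \<inter> X))"
  proof
    fix B assume "B \<in> sets (restrict_space borel X)"
    then obtain B' where B': "B' \<in> sets borel" "B = X \<inter> B'"
      by (auto simp: sets_restrict_space)
    have "h (B \<inter> A \<inter> X) + h ((X - B) \<inter> A \<inter> X) = h (A \<inter> X)" if "A \<subseteq> X" for A
    proof -
      have "B \<inter> A \<inter> X = B' \<inter> A" "(X - B) \<inter> A \<inter> X = A - B'" "A \<inter> X = A"
        using that B' by auto
      then show ?thesis using borel_split[OF B'(1)] by simp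
    qed
    then show "B \<in> lambda_system X (Pow X) (\<lambda>A. h (A \<inter> X))"
      using B' by (auto simp: lambda_system_def)
  qed
  fix A assume A: "A \<subseteq> X"
  obtain B where B: "B \<in> sets borel" "A \<subseteq> B" "h B = h A" using reg by blast
  have "h A \<le> h (B \<inter> X)" "h (B \<inter> X) \<le> h B"
    using A B(2) by (intro h_mono; blast)+
  then have "h (X \<inter> B \<inter> X) = h (A \<inter> X)" using A B by (simp add: Int_absorb2 Int_ac)
  then show "\<exists>B\<in>sets (restrict_space borel X). A \<subseteq> B \<and> h (B \<inter> X) = h (A \<inter> X)"
    using A B by (intro bexI[of _ "X \<inter> B"]) (auto simp: sets_restrict_space)
next
  fix A
  have "h (A \<inter> X) \<le> h X" by (rule h_mono) auto
  then show "h (A \<inter> X) < \<infinity>" using assms(3) by (rule le_less_trans)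
qed (use assms in simp)

end

section \<open>Hausdorff measure\<close>

lemma diameter_le_dist:
  fixes S :: "'a::metric_space set"
  assumes "0 \<le> d" "\<And>x y. x \<in> S \<Longrightarrow> y \<in> S \<Longrightarrow> dist x y \<le> d"
  shows "diameter S \<le> d"
  using assms by (auto simp: diameter_def intro!: cSUP_least)

lemma hausdorff_pre_le:
  assumes "A \<subseteq> (\<Union>i. U i)" "\<And>i. bounded (U i)" "\<And>i. diameter (U i) \<le> \<delta>"
  shows "hausdorff_pre s \<delta> A \<le> (\<Sum>i. ennreal (diameter (U i) powr s))"
  unfolding hausdorff_pre_def using assms by (intro INF_lower) auto

lemma hausdorff_pre_greatest:
  assumes "\<And>U. A \<subseteq> (\<Union>i::nat. U i) \<Longrightarrow> (\<And>i. bounded (U i)) \<Longrightarrow> (\<And>i. diameter (U i) \<le> \<delta>) \<Longrightarrow>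
      x \<le> (\<Sum>i. ennreal (diameter (U i) powr s))"
  shows "x \<le> hausdorff_pre s \<delta> A"
  unfolding hausdorff_pre_def using assms by (intro INF_greatest) auto

lemma hausdorff_pre_approx:
  assumes "hausdorff_pre s \<delta> A < x"
  shows "\<exists>U. A \<subseteq> (\<Union>i::nat. U i) \<and> (\<forall>i. bounded (U i)) \<and> (\<forall>i. diameter (U i) \<le> \<delta>) \<and>
    (\<Sum>i. ennreal (diameter (U i) powr s)) \<le> x"
proof -
  obtain U where "A \<subseteq> (\<Union>i::nat. U i)" "\<forall>i. bounded (U i) \<and> diameter (U i) \<le> \<delta>"
    "(\<Sum>i. ennreal (diameter (U i) powr s)) < x"
    using assms unfolding hausdorff_pre_def INF_less_iff by blast
  then show ?thesis by (intro exI[of _ U]) auto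
qed

lemma hausdorff_pre_mono: "A \<subseteq> B \<Longrightarrow> hausdorff_pre s \<delta> A \<le> hausdorff_pre s \<delta> B"
  by (rule hausdorff_pre_greatest) (auto intro!: hausdorff_pre_le)

lemma hausdorff_pre_antimono: "\<delta> \<le> \<delta>' \<Longrightarrow> hausdorff_pre s \<delta>' A \<le> hausdorff_pre s \<delta> A"
  by (rule hausdorff_pre_greatest) (auto intro!: hausdorff_pre_le intro: order_trans)

lemma hausdorff_pre_empty: "0 \<le> \<delta> \<Longrightarrow> hausdorff_pre s \<delta> {} = 0"
  using hausdorff_pre_le[of "{}" "\<lambda>_. {}" \<delta> s] by simp

text \<open>Covers of the sets \<open>A n\<close>, optimal up to \<open>e * (1/2) ^ Suc n\<close>,
  are enumerated as one sequence by \<open>prod_decode\<close>; the errors add up to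
  \<open>e\<close>.\<close>

lemma hausdorff_pre_UN:
  "hausdorff_pre s \<delta> (\<Union>i::nat. A i) \<le> (\<Sum>i. hausdorff_pre s \<delta> (A i))"
proof (rule ennreal_le_epsilon)
  fix e :: real assume e: "0 < e" and fin: "(\<Sum>i. hausdorff_pre s \<delta> (A i)) < top"
  have "hausdorff_pre s \<delta> (A n) < hausdorff_pre s \<delta> (A n) + e * (1/2)^Suc n" for n
    using e ennreal_suminf_lessD[OF fin, of n] by (auto simp: less_top)
  then have "\<exists>U. A n \<subseteq> (\<Union>i::nat. U i) \<and> (\<forall>i. bounded (U i)) \<and> (\<forall>i. diameter (U i) \<le> \<delta>) \<and>
      (\<Sum>i. ennreal (diameter (U i) powr s)) \<le> hausdorff_pre s \<delta> (A n) + e * (1/2)^Suc n" for n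
    by (rule hausdorff_pre_approx)
  then obtain U where U: "\<And>n. A n \<subseteq> (\<Union>i::nat. U n i)" "\<And>n i. bounded (U n i)"
      "\<And>n i. diameter (U n i) \<le> \<delta>"
      "\<And>n. (\<Sum>i. ennreal (diameter (U n i) powr s)) \<le> hausdorff_pre s \<delta> (A n) + e * (1/2)^Suc n"
    by metis
  define V where "V k = case_prod U (prod_decode k)" for k
  have "hausdorff_pre s \<delta> (\<Union>i. A i) \<le> (\<Sum>k. ennreal (diameter (V k) powr s))"
  proof (rule hausdorff_pre_le)
    show "(\<Union>i. A i) \<subseteq> (\<Union>k. V k)"
    proof
      fix x assume "x \<in> (\<Union>i. A i)"
      then obtain n i where "x \<in> U n i" using U(1) by blast
      then have "x \<in> V (prod_encode (n, i))" by (simp add: V_def)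
      then show "x \<in> (\<Union>k. V k)" by blast
    qed
  qed (simp_all add: V_def U(2,3) split: prod.split)
  also have "\<dots> = (\<Sum>n. \<Sum>i. ennreal (diameter (U n i) powr s))"
    unfolding V_def
    by (rule suminf_ennreal_2dimen[where f = "\<lambda>p. ennreal (diameter (case_prod U p) powr s)"]) simp
  also have "\<dots> \<le> (\<Sum>n. hausdorff_pre s \<delta> (A n) + e * (1/2)^Suc n)"
    by (intro suminf_le allI U) auto
  also have "\<dots> = (\<Sum>n. hausdorff_pre s \<delta> (A n)) + (\<Sum>n. ennreal e * ennreal ((1/2) ^ Suc n))"
    using e by (subst suminf_add[symmetric])
      (auto simp del: ennreal_suminf_cmult simp add: ennreal_mult[symmetric])
  also have "\<dots> = (\<Sum>n. hausdorff_pre s \<delta> (A n)) + e"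
    unfolding ennreal_suminf_cmult
    by (subst suminf_ennreal_eq[OF zero_le_power power_half_series]) auto
  finally show "hausdorff_pre s \<delta> (\<Union>i. A i) \<le> (\<Sum>i. hausdorff_pre s \<delta> (A i)) + ennreal e" .
qed

lemma hausdorff_pre_finite_cover:
  assumes "0 \<le> \<delta>" "finite F" "A \<subseteq> (\<Union>y\<in>F. V y)"
    and V: "\<And>y. y \<in> F \<Longrightarrow> bounded (V y)" "\<And>y. y \<in> F \<Longrightarrow> diameter (V y) \<le> \<delta>"
  shows "hausdorff_pre s \<delta> A \<le> (\<Sum>y\<in>F. ennreal (diameter (V y) powr s))"
proof -
  have "hausdorff_pre s \<delta> A \<le> hausdorff_pre s \<delta> (\<Union>y\<in>F. V y)"
    by (rule hausdorff_pre_mono) fact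
  also have "\<dots> \<le> (\<Sum>y\<in>F. hausdorff_pre s \<delta> (V y))"
    using assms by (intro finite_subadditive_of_countable[where X = UNIV] hausdorff_pre_UN)
      (auto simp: hausdorff_pre_empty)
  also have "\<dots> \<le> (\<Sum>y\<in>F. ennreal (diameter (V y) powr s))"
  proof (rule sum_mono)
    fix y assume "y \<in> F"
    have "hausdorff_pre s \<delta> (V y) \<le> (\<Sum>i. ennreal (diameter (if i = 0 then V y else {}) powr s))"
      using V[OF \<open>y \<in> F\<close>] \<open>0 \<le> \<delta>\<close> by (intro hausdorff_pre_le) (auto split: if_splits)
    also have "\<dots> = ennreal (diameter (V y) powr s)"
      by (subst suminf_finite[of "{0}"]) auto
    finally show "hausdorff_pre s \<delta> (V y) \<le> ennreal (diameter (V y) powr s)" .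
  qed
  finally show ?thesis .
qed

text \<open>A set of diameter at most \<open>\<delta>\<close> cannot meet both \<open>A\<close> and
  \<open>B\<close>. Cutting a cover of the union down to \<open>A\<close> and to \<open>B\<close>
  therefore gives two covers whose costs together do not exceed the original one.\<close>

lemma hausdorff_pre_separated:
  assumes sep: "\<And>x y. x \<in> A \<Longrightarrow> y \<in> B \<Longrightarrow> \<delta> < dist x y" and "0 < s"
  shows "hausdorff_pre s \<delta> A + hausdorff_pre s \<delta> B \<le> hausdorff_pre s \<delta> (A \<union> B)"
proof (rule hausdorff_pre_greatest)
  fix U :: "nat \<Rightarrow> 'a set"
  assume U: "A \<union> B \<subseteq> (\<Union>i. U i)" "\<And>i. bounded (U i)" "\<And>i. diameter (U i) \<le> \<delta>"
  have bd: "bounded (U i \<inter> S)" "diameter (U i \<inter> S) \<le> diameter (U i)" for i S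
    using U(2) by (auto intro: bounded_subset diameter_subset)
  have "hausdorff_pre s \<delta> A + hausdorff_pre s \<delta> B
      \<le> (\<Sum>i. ennreal (diameter (U i \<inter> A) powr s)) + (\<Sum>i. ennreal (diameter (U i \<inter> B) powr s))"
    using U(1) bd order_trans[OF bd(2) U(3)] by (intro add_mono hausdorff_pre_le) auto
  also have "\<dots> = (\<Sum>i. ennreal (diameter (U i \<inter> A) powr s) + ennreal (diameter (U i \<inter> B) powr s))"
    by (rule suminf_add) auto
  also have "\<dots> \<le> (\<Sum>i. ennreal (diameter (U i) powr s))"
  proof (intro suminf_le allI)
    fix i
    have "U i \<inter> A = {} \<or> U i \<inter> B = {}"
    proof (rule ccontr)
      assume "\<not> ?thesis"
      then obtain x y where "x \<in> U i" "x \<in> A" "y \<in> U i" "y \<in> B" by auto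
      then show False
        using sep[of x y] U(3)[of i] diameter_bounded_bound[OF U(2), of x i y] by simp
    qed
    moreover have "0 \<le> diameter (U i \<inter> S)" for S
      using bd(1) by (rule diameter_ge_0)
    ultimately show "ennreal (diameter (U i \<inter> A) powr s) + ennreal (diameter (U i \<inter> B) powr s)
        \<le> ennreal (diameter (U i) powr s)"
      using bd(2) \<open>0 < s\<close> by (auto intro!: ennreal_leI powr_mono2)
  qed auto
  finally show "hausdorff_pre s \<delta> A + hausdorff_pre s \<delta> B \<le> (\<Sum>i. ennreal (diameter (U i) powr s))" .
qed


lemma hausdorff_pre_le_measure: "0 < \<delta> \<Longrightarrow> hausdorff_pre s \<delta> A \<le> hausdorff_measure s A"
  unfolding hausdorff_measure_def by (rule SUP_upper) simp

lemma hausdorff_measure_le: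
  assumes "0 < \<delta>0" "\<And>\<delta>. 0 < \<delta> \<Longrightarrow> \<delta> \<le> \<delta>0 \<Longrightarrow> hausdorff_pre s \<delta> A \<le> x"
  shows "hausdorff_measure s A \<le> x"
  unfolding hausdorff_measure_def
proof (rule SUP_least)
  fix \<delta> :: real assume "\<delta> \<in> {0<..}"
  then have "hausdorff_pre s (min \<delta> \<delta>0) A \<le> x" using assms by simp
  then show "hausdorff_pre s \<delta> A \<le> x"
    using hausdorff_pre_antimono[of "min \<delta> \<delta>0" \<delta> s A] by simp
qed

lemma metric_outer_measure_hausdorff:
  assumes "0 < s"
  shows "metric_outer_measure (hausdorff_measure s)"
proof
  show "hausdorff_measure s {} = 0"
    unfolding hausdorff_measure_def by (simp add: hausdorff_pre_empty)
next
  fix A B :: "'a set"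
  assume "A \<subseteq> B"
  then show "hausdorff_measure s A \<le> hausdorff_measure s B"
    unfolding hausdorff_measure_def by (intro SUP_mono) (auto intro: hausdorff_pre_mono)
next
  fix A :: "nat \<Rightarrow> 'a set"
  show "hausdorff_measure s (\<Union>i. A i) \<le> (\<Sum>i. hausdorff_measure s (A i))"
    unfolding hausdorff_measure_def[of s "\<Union>i. A i"]
  proof (rule SUP_least)
    fix \<delta> :: real assume "\<delta> \<in> {0<..}"
    then have "(\<Sum>i. hausdorff_pre s \<delta> (A i)) \<le> (\<Sum>i. hausdorff_measure s (A i))"
      by (intro suminf_le hausdorff_pre_le_measure) auto
    then show "hausdorff_pre s \<delta> (\<Union>i. A i) \<le> (\<Sum>i. hausdorff_measure s (A i))"
      using hausdorff_pre_UN order_trans by blast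
  qed
next
  fix d :: real and A B :: "'a set"
  assume d: "0 < d" and sep: "\<And>x y. x \<in> A \<Longrightarrow> y \<in> B \<Longrightarrow> d \<le> dist x y"
  have "hausdorff_pre s \<delta> A + hausdorff_pre s \<delta>' B \<le> hausdorff_measure s (A \<union> B)"
    if "0 < \<delta>" "0 < \<delta>'" for \<delta> \<delta>'
  proof -
    \<comment> \<open>A common scale below the gap \<open>d\<close> at which
      \<open>hausdorff_pre_separated\<close> applies. Since \<open>\<delta>\<close> and
      \<open>\<delta>'\<close> are independent, the two suprema can then be taken one after the
      other.\<close>
    define m where "m = min (min \<delta> \<delta>') (d / 2)"
    have m: "0 < m" "m < d" "m \<le> \<delta>" "m \<le> \<delta>'" using that d by (auto simp: m_def)
    have "hausdorff_pre s \<delta> A + hausdorff_pre s \<delta>' B \<le> hausdorff_pre s m A + hausdorff_pre s m B"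
      using m by (intro add_mono hausdorff_pre_antimono)
    also have "\<dots> \<le> hausdorff_pre s m (A \<union> B)"
      using sep m(2) assms by (intro hausdorff_pre_separated) force+
    also have "\<dots> \<le> hausdorff_measure s (A \<union> B)"
      using m(1) by (rule hausdorff_pre_le_measure)
    finally show ?thesis .
  qed
  then have "hausdorff_measure s A + hausdorff_pre s \<delta>' B \<le> hausdorff_measure s (A \<union> B)"
    if "0 < \<delta>'" for \<delta>'
    unfolding hausdorff_measure_def[of s A] using that
    by (subst ennreal_SUP_add_left[symmetric]) (auto intro!: SUP_least)
  then show "hausdorff_measure s A + hausdorff_measure s B \<le> hausdorff_measure s (A \<union> B)"
    unfolding hausdorff_measure_def[of s B]
    by (subst ennreal_SUP_add_right) (auto intro!: SUP_least)
qed

text \<open>Closures have the same diameters, so near-optimal covers at the scales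
  \<open>e n\<close> may be taken closed. The intersection over \<open>n\<close> of their unions is
  Borel, contains \<open>A\<close>, and is covered at each scale at the same cost. If the measure of
  \<open>A\<close> is infinite, the whole space serves.\<close>

lemma hausdorff_measure_borel_regular:
  fixes A :: "'a::metric_space set"
  assumes "0 < s"
  shows "\<exists>B\<in>sets borel. A \<subseteq> B \<and> hausdorff_measure s B = hausdorff_measure s A"
proof (cases "hausdorff_measure s A = top")
  case True
  interpret metric_outer_measure "hausdorff_measure s :: 'a set \<Rightarrow> ennreal"
    using assms by (rule metric_outer_measure_hausdorff)
  have "hausdorff_measure s A \<le> hausdorff_measure s (UNIV :: 'a set)" by (rule h_mono) simp
  then show ?thesis using True by (intro bexI[of _ UNIV]) (auto simp: top_unique)
next
  case False
  interpret metric_outer_measure "hausdorff_measure s :: 'a set \<Rightarrow> ennreal"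
    using assms by (rule metric_outer_measure_hausdorff)
  define e where "e n = 1 / real (Suc n)" for n
  have e: "0 < e n" for n by (simp add: e_def)
  have "hausdorff_pre s (e n) A < hausdorff_measure s A + ennreal (e n)" for n
  proof -
    have "hausdorff_pre s (e n) A \<le> hausdorff_measure s A"
      using e by (rule hausdorff_pre_le_measure)
    also have "\<dots> < hausdorff_measure s A + ennreal (e n)"
      using False e[of n] by (auto simp: less_top)
    finally show ?thesis .
  qed
  then have "\<exists>U. A \<subseteq> (\<Union>i::nat. U i) \<and> (\<forall>i. bounded (U i)) \<and> (\<forall>i. diameter (U i) \<le> e n) \<and>
      (\<Sum>i. ennreal (diameter (U i) powr s)) \<le> hausdorff_measure s A + ennreal (e n)" for n
    by (rule hausdorff_pre_approx)
  then obtain U where U: "\<And>n. A \<subseteq> (\<Union>i::nat. U n i)" "\<And>n i. bounded (U n i)"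
      "\<And>n i. diameter (U n i) \<le> e n"
      "\<And>n. (\<Sum>i. ennreal (diameter (U n i) powr s)) \<le> hausdorff_measure s A + ennreal (e n)"
    by metis
  define B where "B = (\<Inter>n. \<Union>i. closure (U n i))"
  have pre_B: "hausdorff_pre s (e n) B \<le> hausdorff_measure s A + ennreal (e n)" for n
  proof -
    have "hausdorff_pre s (e n) B \<le> (\<Sum>i. ennreal (diameter (closure (U n i)) powr s))"
      using U by (intro hausdorff_pre_le) (auto simp: B_def diameter_closure)
    then show ?thesis using U by (simp add: diameter_closure order_trans)
  qed
  have "hausdorff_measure s B \<le> hausdorff_measure s A"
  proof (rule ennreal_le_epsilon)
    fix \<eta> :: real assume "0 < \<eta>"
    show "hausdorff_measure s B \<le> hausdorff_measure s A + ennreal \<eta>"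
      unfolding hausdorff_measure_def[of s B]
    proof (rule SUP_least)
      fix \<delta> :: real assume "\<delta> \<in> {0<..}"
      then obtain n where n: "e n < min \<delta> \<eta>"
        using nat_approx_posE[of "min \<delta> \<eta>"] \<open>0 < \<eta>\<close> unfolding e_def by auto
      have "hausdorff_pre s \<delta> B \<le> hausdorff_pre s (e n) B"
        using n by (intro hausdorff_pre_antimono) simp
      also have "\<dots> \<le> hausdorff_measure s A + ennreal (e n)" by (rule pre_B)
      also have "\<dots> \<le> hausdorff_measure s A + ennreal \<eta>"
        using n by (intro add_left_mono ennreal_leI) simp
      finally show "hausdorff_pre s \<delta> B \<le> hausdorff_measure s A + ennreal \<eta>" .
    qed
  qed
  moreover have "A \<subseteq> B"
  proof -
    have "A \<subseteq> (\<Union>i. closure (U n i))" for n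
    proof
      fix x assume "x \<in> A"
      then obtain i where "x \<in> U n i" using U(1)[of n] by blast
      then show "x \<in> (\<Union>i. closure (U n i))" using closure_subset[of "U n i"] by blast
    qed
    then show ?thesis unfolding B_def by blast
  qed
  ultimately show ?thesis
    by (intro bexI[of _ B]) (auto intro!: antisym h_mono simp: B_def)
qed

section \<open>Hausdorff measure under Lipschitz maps and similitudes\<close>

lemma hausdorff_pre_lipschitz_image:
  assumes "0 < L" "0 < s" and lip: "\<And>x y. x \<in> A \<Longrightarrow> y \<in> A \<Longrightarrow> dist (f x) (f y) \<le> L * dist x y"
  shows "hausdorff_pre s (L * \<delta>) (f ` A) \<le> ennreal (L powr s) * hausdorff_pre s \<delta> A"
proof -
  \<comment> \<open>With the factor on this side, the infimum over the covers of \<open>A\<close>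
    can be taken directly. Covering sets are cut down to \<open>A\<close> because \<open>f\<close>
    is controlled only there.\<close>
  have "ennreal (L powr (- s)) * hausdorff_pre s (L * \<delta>) (f ` A) \<le> hausdorff_pre s \<delta> A"
  proof (rule hausdorff_pre_greatest)
    fix U :: "nat \<Rightarrow> 'a set"
    assume U: "A \<subseteq> (\<Union>i. U i)" "\<And>i. bounded (U i)" "\<And>i. diameter (U i) \<le> \<delta>"
    have dist_le: "dist x y \<le> L * diameter (U i)"
      if xy: "x \<in> f ` (U i \<inter> A)" "y \<in> f ` (U i \<inter> A)" for x y i
    proof -
      obtain x' y' where xy: "x = f x'" "y = f y'" "x' \<in> U i" "y' \<in> U i" "x' \<in> A" "y' \<in> A"
        using xy by auto
      then have "dist x y \<le> L * dist x' y'" using lip by simp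
      also have "\<dots> \<le> L * diameter (U i)"
        using diameter_bounded_bound[OF U(2) xy(3,4)] \<open>0 < L\<close> by simp
      finally show ?thesis .
    qed
    have bd: "bounded (f ` (U i \<inter> A))" for i
      using dist_le bounded_two_points by blast
    have diam: "diameter (f ` (U i \<inter> A)) \<le> L * diameter (U i)" for i
      using dist_le diameter_ge_0[OF U(2)] \<open>0 < L\<close> by (intro diameter_le_dist) auto
    have "hausdorff_pre s (L * \<delta>) (f ` A) \<le> (\<Sum>i. ennreal (diameter (f ` (U i \<inter> A)) powr s))"
    proof (rule hausdorff_pre_le)
      show "f ` A \<subseteq> (\<Union>i. f ` (U i \<inter> A))" using U(1) by blast
      show "diameter (f ` (U i \<inter> A)) \<le> L * \<delta>" for i
        using diam[of i] U(3)[of i] \<open>0 < L\<close> by (meson mult_le_cancel_left_pos order_trans)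
    qed (rule bd)
    also have "\<dots> \<le> (\<Sum>i. ennreal (L powr s) * ennreal (diameter (U i) powr s))"
    proof (intro suminf_le allI)
      fix i
      have "diameter (f ` (U i \<inter> A)) powr s \<le> (L * diameter (U i)) powr s"
        using diam[of i] diameter_ge_0[OF bd] \<open>0 < s\<close> by (intro powr_mono2) auto
      also have "\<dots> = L powr s * diameter (U i) powr s"
        using \<open>0 < L\<close> diameter_ge_0[OF U(2)] by (simp add: powr_mult)
      finally show "ennreal (diameter (f ` (U i \<inter> A)) powr s)
          \<le> ennreal (L powr s) * ennreal (diameter (U i) powr s)"
        by (simp flip: ennreal_mult add: ennreal_leI)
    qed auto
    finally have "ennreal (L powr (- s)) * hausdorff_pre s (L * \<delta>) (f ` A)
        \<le> ennreal (L powr (- s)) * (ennreal (L powr s) * (\<Sum>i. ennreal (diameter (U i) powr s)))"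
      by (intro mult_left_mono) auto
    also have "\<dots> = ennreal (L powr (- s) * L powr s) * (\<Sum>i. ennreal (diameter (U i) powr s))"
      by (simp add: ennreal_mult mult.assoc)
    finally show "ennreal (L powr (- s)) * hausdorff_pre s (L * \<delta>) (f ` A)
        \<le> (\<Sum>i. ennreal (diameter (U i) powr s))"
      using \<open>0 < L\<close> by (simp flip: powr_add)
  qed
  then have "ennreal (L powr s) * (ennreal (L powr (- s)) * hausdorff_pre s (L * \<delta>) (f ` A))
      \<le> ennreal (L powr s) * hausdorff_pre s \<delta> A"
    by (intro mult_left_mono) auto
  moreover have "ennreal (L powr s) * (ennreal (L powr (- s)) * hausdorff_pre s (L * \<delta>) (f ` A))
      = ennreal (L powr s * L powr (- s)) * hausdorff_pre s (L * \<delta>) (f ` A)"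
    by (simp add: ennreal_mult mult.assoc)
  ultimately show ?thesis using \<open>0 < L\<close> by (simp flip: powr_add)
qed

lemma hausdorff_measure_lipschitz_image:
  assumes "0 < L" "0 < s" and lip: "\<And>x y. x \<in> A \<Longrightarrow> y \<in> A \<Longrightarrow> dist (f x) (f y) \<le> L * dist x y"
  shows "hausdorff_measure s (f ` A) \<le> ennreal (L powr s) * hausdorff_measure s A"
  unfolding hausdorff_measure_def[of s "f ` A"]
proof (rule SUP_least)
  fix \<delta> :: real assume "\<delta> \<in> {0<..}"
  then have "hausdorff_pre s (L * (\<delta> / L)) (f ` A) \<le> ennreal (L powr s) * hausdorff_pre s (\<delta> / L) A"
    using assms by (intro hausdorff_pre_lipschitz_image)
  also have "\<dots> \<le> ennreal (L powr s) * hausdorff_measure s A"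
    using \<open>\<delta> \<in> {0<..}\<close> \<open>0 < L\<close> by (intro mult_left_mono hausdorff_pre_le_measure) auto
  finally show "hausdorff_pre s \<delta> (f ` A) \<le> ennreal (L powr s) * hausdorff_measure s A"
    using \<open>0 < L\<close> by simp
qed

text \<open>Both \<open>f\<close> and its inverse on the image are Lipschitz, with constants
  \<open>\<rho>\<close> and \<open>1 / \<rho>\<close>, and the two resulting factors cancel.\<close>

lemma hausdorff_measure_similitude_image:
  assumes "0 < \<rho>" "0 < s" and sim: "\<And>x y. dist (f x) (f y) = \<rho> * dist x y"
  shows "hausdorff_measure s (f ` A) = ennreal (\<rho> powr s) * hausdorff_measure s A"
proof (rule antisym)
  show "hausdorff_measure s (f ` A) \<le> ennreal (\<rho> powr s) * hausdorff_measure s A"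
    using assms by (intro hausdorff_measure_lipschitz_image) auto
  have "inj f" using sim \<open>0 < \<rho>\<close> by (metis dist_eq_0_iff injI mult_eq_0_iff order_less_irrefl)
  have "dist (inv f x) (inv f y) \<le> 1 / \<rho> * dist x y" if "x \<in> f ` A" "y \<in> f ` A" for x y
    using that sim \<open>0 < \<rho>\<close> \<open>inj f\<close> by auto
  moreover have "inv f ` f ` A = A" using \<open>inj f\<close> by (simp add: image_inv_f_f)
  ultimately have "hausdorff_measure s A \<le> ennreal ((1 / \<rho>) powr s) * hausdorff_measure s (f ` A)"
    using hausdorff_measure_lipschitz_image[of "1 / \<rho>" s "f ` A" "inv f"] assms by simp
  then have "ennreal (\<rho> powr s) * hausdorff_measure s A
      \<le> ennreal (\<rho> powr s) * (ennreal ((1 / \<rho>) powr s) * hausdorff_measure s (f ` A))"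
    by (intro mult_left_mono) auto
  also have "\<dots> = ennreal (\<rho> powr s * (1 / \<rho>) powr s) * hausdorff_measure s (f ` A)"
    by (simp add: ennreal_mult mult.assoc)
  also have "\<dots> = hausdorff_measure s (f ` A)"
    using \<open>0 < \<rho>\<close> by (simp flip: powr_mult)
  finally show "ennreal (\<rho> powr s) * hausdorff_measure s A \<le> hausdorff_measure s (f ` A)" .
qed

section \<open>Ahlfors regular measures\<close>

lemma ennreal_mult_left_assoc:
  "0 \<le> a \<Longrightarrow> 0 \<le> b \<Longrightarrow> ennreal a * (ennreal b * x) = ennreal (a * b) * x"
  by (simp add: ennreal_mult mult.assoc)

lemma metric_measure_empty: "metric_measure X \<nu> \<Longrightarrow> \<nu> {} = 0"
  by (simp add: metric_measure_def outer_measure_space_def positive_def)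

lemma metric_measure_mono:
  assumes "metric_measure X \<nu>" "A \<subseteq> B" "B \<subseteq> X"
  shows "\<nu> A \<le> \<nu> B"
  using assms unfolding metric_measure_def outer_measure_space_def increasing_def by auto

text \<open>\<open>countably_subadditive\<close> speaks about disjoint families. The family
  \<open>disjointed A\<close> has the same union, and monotonicity leads back to the sets
  \<open>A i\<close>.\<close>

lemma metric_measure_UN:
  assumes m: "metric_measure X \<nu>" and sub: "\<And>i::nat. A i \<subseteq> X"
  shows "\<nu> (\<Union>i. A i) \<le> (\<Sum>i. \<nu> (A i))"
proof -
  have D: "disjointed A i \<subseteq> A i" for i by (rule disjointed_subset)
  have "countably_subadditive (Pow X) \<nu>"
    using m by (simp add: metric_measure_def outer_measure_space_def)
  moreover have "range (disjointed A) \<subseteq> Pow X" "(\<Union>i. disjointed A i) \<in> Pow X"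
    using order_trans[OF D sub] by (auto simp del: UN_disjointed_eq)
  ultimately have "\<nu> (\<Union>i. disjointed A i) \<le> (\<Sum>i. \<nu> (disjointed A i))"
    using disjoint_family_disjointed[of A] by (simp only: countably_subadditive_def)
  also have "\<dots> \<le> (\<Sum>i. \<nu> (A i))"
    using sub D by (intro suminf_le allI metric_measure_mono[OF m]) auto
  finally show ?thesis by (simp add: UN_disjointed_eq)
qed

lemma metric_measure_finite_UN:
  assumes "metric_measure X \<nu>" "finite I" "\<And>i. i \<in> I \<Longrightarrow> A i \<subseteq> X"
  shows "\<nu> (\<Union>i\<in>I. A i) \<le> (\<Sum>i\<in>I. \<nu> (A i))"
  using assms
  by (intro finite_subadditive_of_countable[where X = X] metric_measure_empty metric_measure_UN[OF assms(1)])

text \<open>Borel sets of \<open>X\<close> split every subset of \<open>X\<close> additively, so the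
  sets are split off the union one by one.\<close>

lemma metric_measure_sum_disjoint:
  assumes m: "metric_measure X \<nu>" and "finite F"
    and "\<And>y. y \<in> F \<Longrightarrow> B y \<in> sets (restrict_space borel X)" "disjoint_family_on B F"
  shows "(\<Sum>y\<in>F. \<nu> (B y)) = \<nu> (\<Union>y\<in>F. B y)"
  using assms(2-4)
proof (induction F)
  case empty
  then show ?case using metric_measure_empty[OF m] by simp
next
  case (insert y F)
  have sub: "B z \<subseteq> X" if "z \<in> insert y F" for z
    using insert.prems(1)[OF that] sets.sets_into_space[of "B z" "restrict_space borel X"]
    by (simp add: space_restrict_space)
  have dis: "B y \<inter> B z = {}" if "z \<in> F" for z
    using insert.prems(2) insert.hyps that by (auto simp: disjoint_family_on_def)
  have "B y \<in> lambda_system X (Pow X) \<nu>"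
    using m insert.prems(1)[of y] by (auto simp: metric_measure_def)
  moreover have "(\<Union>z\<in>insert y F. B z) \<in> Pow X" using sub by blast
  ultimately have "\<nu> (B y \<inter> (\<Union>z\<in>insert y F. B z)) + \<nu> ((X - B y) \<inter> (\<Union>z\<in>insert y F. B z))
      = \<nu> (\<Union>z\<in>insert y F. B z)"
    unfolding lambda_system_def by blast
  moreover have "B y \<inter> (\<Union>z\<in>insert y F. B z) = B y" by auto
  moreover have "(X - B y) \<inter> (\<Union>z\<in>insert y F. B z) = (\<Union>z\<in>F. B z)"
    using dis sub by blast
  moreover have "(\<Sum>z\<in>F. \<nu> (B z)) = \<nu> (\<Union>z\<in>F. B z)"
    using insert.prems by (intro insert.IH) (auto simp: disjoint_family_on_def)
  ultimately show ?case using insert.hyps by simp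
qed

text \<open>The upper bound is asked for all radii, because enlarged balls occur below; the lower
  bound must stop at some \<open>D\<close> when \<open>X\<close> is bounded. For \<open>C\<close>
  this \<open>D\<close> is half the distance of two points, for \<open>EC\<close> it is the
  diameter.\<close>

locale ahlfors_regular =
  fixes s c D :: real and X :: "'a::metric_space set" and \<nu> :: "'a set \<Rightarrow> ennreal"
  assumes s_pos: "0 < s" and c_ge_1: "1 \<le> c" and D_pos: "0 < D"
    and measure: "metric_measure X \<nu>"
    and upper: "\<And>x r. x \<in> X \<Longrightarrow> 0 < r \<Longrightarrow> \<nu> (cball x r \<inter> X) \<le> ennreal (c * r powr s)"
    and lower: "\<And>x r. x \<in> X \<Longrightarrow> 0 < r \<Longrightarrow> r \<le> D \<Longrightarrow> ennreal (r powr s / c) \<le> \<nu> (cball x r \<inter> X)"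
begin

text \<open>The balls of radius \<open>\<delta> / 2\<close> around the points of \<open>F\<close>
  are disjoint and lie in the ball of radius \<open>2 * r\<close>. Comparing masses gives the
  quotient \<open>2 * r / (\<delta> / 2)\<close>, and one factor \<open>c\<close> from each of the
  two bounds.\<close>

lemma packing_bound:
  assumes x: "x \<in> X" and \<delta>: "0 < \<delta>" "\<delta> \<le> r" "\<delta> \<le> D"
    and F: "finite F" "F \<subseteq> cball x r \<inter> X" "\<And>y z. y \<in> F \<Longrightarrow> z \<in> F \<Longrightarrow> y \<noteq> z \<Longrightarrow> \<delta> < dist y z"
  shows "real (card F) \<le> c\<^sup>2 * (4 * r / \<delta>) powr s"
proof -
  let ?B = "\<lambda>y. cball y (\<delta> / 2) \<inter> X"
  have "disjoint_family_on ?B F"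
    unfolding disjoint_family_on_def
  proof (intro ballI impI)
    fix y z assume yz: "y \<in> F" "z \<in> F" "y \<noteq> z"
    show "?B y \<inter> ?B z = {}"
    proof (rule ccontr)
      assume "?B y \<inter> ?B z \<noteq> {}"
      then obtain w where "dist y w \<le> \<delta> / 2" "dist z w \<le> \<delta> / 2" by auto
      then have "dist y z \<le> \<delta>" using dist_triangle2[of y z w] by simp
      then show False using F(3)[OF yz] by simp
    qed
  qed
  moreover have "?B y \<in> sets (restrict_space borel X)" for y
    unfolding sets_restrict_space by (intro image_eqI[of _ _ "cball y (\<delta> / 2)"]) auto
  ultimately have "(\<Sum>y\<in>F. \<nu> (?B y)) = \<nu> (\<Union>y\<in>F. ?B y)"
    using F(1) by (intro metric_measure_sum_disjoint[OF measure])
  also have "\<dots> \<le> \<nu> (cball x (2 * r) \<inter> X)"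
  proof (rule metric_measure_mono[OF measure])
    show "(\<Union>y\<in>F. ?B y) \<subseteq> cball x (2 * r) \<inter> X"
    proof
      fix w assume "w \<in> (\<Union>y\<in>F. ?B y)"
      then obtain y where "y \<in> F" "dist y w \<le> \<delta> / 2" "w \<in> X" by auto
      moreover have "dist x y \<le> r" using F(2) \<open>y \<in> F\<close> by auto
      ultimately show "w \<in> cball x (2 * r) \<inter> X"
        using dist_triangle[of x w y] \<delta> by simp
    qed
  qed auto
  also have "\<dots> \<le> ennreal (c * (2 * r) powr s)"
    using x \<delta> by (intro upper) auto
  finally have "(\<Sum>y\<in>F. ennreal ((\<delta> / 2) powr s / c)) \<le> ennreal (c * (2 * r) powr s)"
    using F(2) \<delta> by (elim order_trans[rotated], intro sum_mono lower) auto
  moreover have "(\<Sum>y\<in>F. ennreal ((\<delta> / 2) powr s / c)) = ennreal (real (card F) * ((\<delta> / 2) powr s / c))"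
    using c_ge_1 by (subst sum_ennreal) auto
  ultimately have "ennreal (real (card F) * ((\<delta> / 2) powr s / c)) \<le> ennreal (c * (2 * r) powr s)"
    by simp
  then have "real (card F) * ((\<delta> / 2) powr s / c) \<le> c * (2 * r) powr s"
    using c_ge_1 by (simp add: ennreal_le_iff)
  then have "real (card F) * (\<delta> / 2) powr s \<le> c\<^sup>2 * (2 * r) powr s"
    using c_ge_1 by (simp add: field_simps power2_eq_square)
  then have "real (card F) \<le> c\<^sup>2 * ((2 * r) powr s / (\<delta> / 2) powr s)"
    using \<delta> by (simp add: field_simps)
  also have "(2 * r) powr s / (\<delta> / 2) powr s = (4 * r / \<delta>) powr s"
    using \<delta> by (simp add: powr_divide[symmetric])
  finally show ?thesis .
qed

text \<open>A \<open>\<delta>\<close>-separated subset of the ball with the largest possible number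
  of points, which exists by \<open>packing_bound\<close>, is a \<open>\<delta>\<close>-net: an
  uncovered point could be added to it.\<close>

lemma covering_bound:
  assumes x: "x \<in> X" and \<delta>: "0 < \<delta>" "\<delta> \<le> r" "\<delta> \<le> D"
  shows "\<exists>F. finite F \<and> F \<subseteq> X \<and> cball x r \<inter> X \<subseteq> (\<Union>y\<in>F. cball y \<delta> \<inter> X) \<and>
    real (card F) \<le> c\<^sup>2 * (4 * r / \<delta>) powr s"
proof -
  define P where "P F \<longleftrightarrow> finite F \<and> F \<subseteq> cball x r \<inter> X \<and> (\<forall>y\<in>F. \<forall>z\<in>F. y \<noteq> z \<longrightarrow> \<delta> < dist y z)" for F
  have bd: "real (card F) \<le> c\<^sup>2 * (4 * r / \<delta>) powr s" if "P F" for F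
    using that \<delta> by (intro packing_bound[OF x]) (auto simp: P_def)
  have "card F < Suc (nat \<lfloor>c\<^sup>2 * (4 * r / \<delta>) powr s\<rfloor>)" if "P F" for F
    using bd[OF that] by (simp add: le_nat_floor less_Suc_eq_le)
  moreover have "P {}" by (simp add: P_def)
  ultimately obtain F where F: "P F" "\<And>G. P G \<Longrightarrow> card G \<le> card F"
    using ex_has_greatest_nat[of P "{}" card] by blast
  have "cball x r \<inter> X \<subseteq> (\<Union>y\<in>F. cball y \<delta> \<inter> X)"
  proof (rule ccontr)
    assume "\<not> ?thesis"
    then obtain z where z: "z \<in> cball x r \<inter> X" "\<And>y. y \<in> F \<Longrightarrow> \<delta> < dist y z"
      by force
    then have "z \<notin> F" using \<delta>(1) by force
    have "P (insert z F)"
      using F(1) z by (auto simp: P_def dist_commute)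
    then have "card (insert z F) \<le> card F" by (rule F(2))
    then show False using F(1) \<open>z \<notin> F\<close> by (simp add: P_def)
  qed
  then show ?thesis using F(1) bd[OF F(1)] by (intro exI[of _ F]) (auto simp: P_def)
qed

text \<open>Balls of radius \<open>\<delta> / 2\<close> have diameter at most
  \<open>\<delta>\<close>, which turns the \<open>4\<close> of \<open>covering_bound\<close> into
  \<open>8\<close>. The powers of \<open>\<delta>\<close> in the number of balls and in their cost
  cancel.\<close>

lemma hausdorff_measure_upper:
  assumes x: "x \<in> X" and r: "0 < r"
  shows "hausdorff_measure s (cball x r \<inter> X) \<le> ennreal (c\<^sup>2 * 8 powr s * r powr s)"
proof (rule hausdorff_measure_le[of "min r D"])
  show "0 < min r D" using r D_pos by simp
  fix \<delta> assume \<delta>: "0 < \<delta>" "\<delta> \<le> min r D"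
  obtain F where F: "finite F" "F \<subseteq> X" "cball x r \<inter> X \<subseteq> (\<Union>y\<in>F. cball y (\<delta> / 2) \<inter> X)"
    "real (card F) \<le> c\<^sup>2 * (4 * r / (\<delta> / 2)) powr s"
    using covering_bound[OF x, of "\<delta> / 2" r] \<delta> by auto
  have diam: "diameter (cball y (\<delta> / 2) \<inter> X) \<le> \<delta>" for y
  proof (rule diameter_le_dist)
    fix u v assume "u \<in> cball y (\<delta> / 2) \<inter> X" "v \<in> cball y (\<delta> / 2) \<inter> X"
    then show "dist u v \<le> \<delta>" using dist_triangle3[of u v y] by simp
  qed (use \<delta> in simp)
  have bd: "bounded (cball y (\<delta> / 2) \<inter> X)" for y by (auto intro: bounded_subset)
  have "hausdorff_pre s \<delta> (cball x r \<inter> X) \<le> (\<Sum>y\<in>F. ennreal (diameter (cball y (\<delta> / 2) \<inter> X) powr s))"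
    using \<delta> F diam bd by (intro hausdorff_pre_finite_cover) auto
  also have "\<dots> \<le> (\<Sum>y\<in>F. ennreal (\<delta> powr s))"
    using diam s_pos diameter_ge_0[OF bd] by (intro sum_mono ennreal_leI powr_mono2) auto
  also have "\<dots> = ennreal (real (card F) * \<delta> powr s)"
    by (simp add: ennreal_mult ennreal_of_nat_eq_real_of_nat)
  also have "\<dots> \<le> ennreal (c\<^sup>2 * (4 * r / (\<delta> / 2)) powr s * \<delta> powr s)"
    using F(4) by (intro ennreal_leI mult_right_mono) auto
  also have "(4 * r / (\<delta> / 2)) powr s = 8 powr s * r powr s / \<delta> powr s"
    using \<delta> r by (simp add: powr_divide powr_mult)
  also have "c\<^sup>2 * (8 powr s * r powr s / \<delta> powr s) * \<delta> powr s = c\<^sup>2 * 8 powr s * r powr s"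
    using \<delta> by simp
  finally show "hausdorff_pre s \<delta> (cball x r \<inter> X) \<le> ennreal (c\<^sup>2 * 8 powr s * r powr s)" .
qed

text \<open>
  This is the mass distribution principle. A covering set with a single point has diameter \<open>0\<close>; that
  points are null sets follows by letting the radius in the upper bound tend to \<open>0\<close>.
\<close>
lemma measure_le_hausdorff:
  assumes "A \<subseteq> X"
  shows "\<nu> A \<le> ennreal c * hausdorff_measure s A"
proof -
  have set_le: "\<nu> (V \<inter> A) \<le> ennreal (c * diameter V powr s)" if "bounded V" for V
  proof (cases "V \<inter> A = {}")
    case True
    then show ?thesis using metric_measure_empty[OF measure] by simp
  next
    case False
    then obtain x where x: "x \<in> V" "x \<in> A" by auto
    have ball: "\<nu> (V \<inter> A) \<le> ennreal (c * r powr s)" if "diameter V \<le> r" "0 < r" for r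
    proof -
      have "V \<inter> A \<subseteq> cball x r \<inter> X"
        using diameter_bounded_bound[OF \<open>bounded V\<close> x(1)] that assms by force
      then have "\<nu> (V \<inter> A) \<le> \<nu> (cball x r \<inter> X)"
        by (intro metric_measure_mono[OF measure]) auto
      also have "\<dots> \<le> ennreal (c * r powr s)" using x assms that by (intro upper) auto
      finally show ?thesis .
    qed
    show ?thesis
    proof (cases "diameter V = 0")
      case False
      then show ?thesis using ball[of "diameter V"] diameter_ge_0[OF that] by simp
    next
      case True
      have "\<nu> (V \<inter> A) \<le> 0 + ennreal e" if "0 < e" for e
      proof -
        have "0 < (e / c) powr (1 / s)" using \<open>0 < e\<close> c_ge_1 by simp
        then have "\<nu> (V \<inter> A) \<le> ennreal (c * ((e / c) powr (1 / s)) powr s)"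
          using True by (intro ball) auto
        then show ?thesis using \<open>0 < e\<close> c_ge_1 s_pos by (simp add: powr_powr)
      qed
      then have "\<nu> (V \<inter> A) \<le> 0" using ennreal_le_epsilon by blast
      then show ?thesis by simp
    qed
  qed
  have "ennreal (1 / c) * \<nu> A \<le> hausdorff_pre s 1 A"
  proof (rule hausdorff_pre_greatest)
    fix U :: "nat \<Rightarrow> 'a set"
    assume U: "A \<subseteq> (\<Union>i. U i)" "\<And>i. bounded (U i)"
    have "\<nu> A = \<nu> (\<Union>i. U i \<inter> A)" using U(1) by (intro arg_cong[of _ _ \<nu>]) blast
    also have "\<dots> \<le> (\<Sum>i. \<nu> (U i \<inter> A))"
      using assms by (intro metric_measure_UN[OF measure]) auto
    also have "\<dots> \<le> (\<Sum>i. ennreal c * ennreal (diameter (U i) powr s))"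
      using set_le[OF U(2)] c_ge_1 by (intro suminf_le allI) (auto simp: ennreal_mult)
    finally have "ennreal (1 / c) * \<nu> A
        \<le> ennreal (1 / c) * (ennreal c * (\<Sum>i. ennreal (diameter (U i) powr s)))"
      by (intro mult_left_mono) auto
    also have "\<dots> = ennreal (1 / c * c) * (\<Sum>i. ennreal (diameter (U i) powr s))"
      using c_ge_1 by (intro ennreal_mult_left_assoc) auto
    finally show "ennreal (1 / c) * \<nu> A \<le> (\<Sum>i. ennreal (diameter (U i) powr s))"
      using c_ge_1 by simp
  qed
  also have "\<dots> \<le> hausdorff_measure s A" by (rule hausdorff_pre_le_measure) simp
  finally have "ennreal c * (ennreal (1 / c) * \<nu> A) \<le> ennreal c * hausdorff_measure s A"
    by (intro mult_left_mono) auto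
  moreover have "ennreal c * (ennreal (1 / c) * \<nu> A) = ennreal (c * (1 / c)) * \<nu> A"
    using c_ge_1 by (intro ennreal_mult_left_assoc) auto
  ultimately show ?thesis using c_ge_1 by simp
qed

lemma hausdorff_measure_lower:
  assumes "x \<in> X" "0 < r" "r \<le> D"
  shows "ennreal (r powr s / c\<^sup>2) \<le> hausdorff_measure s (cball x r \<inter> X)"
proof -
  have "ennreal (r powr s / c) \<le> ennreal c * hausdorff_measure s (cball x r \<inter> X)"
    using lower[OF assms] measure_le_hausdorff[of "cball x r \<inter> X"] by (meson Int_lower2 order_trans)
  then have "ennreal (1 / c) * ennreal (r powr s / c)
      \<le> ennreal (1 / c) * (ennreal c * hausdorff_measure s (cball x r \<inter> X))"
    by (intro mult_left_mono) auto
  moreover have "ennreal (1 / c) * (ennreal c * hausdorff_measure s (cball x r \<inter> X))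
      = ennreal (1 / c * c) * hausdorff_measure s (cball x r \<inter> X)"
    using c_ge_1 by (intro ennreal_mult_left_assoc) auto
  moreover have "ennreal (1 / c) * ennreal (r powr s / c) = ennreal (r powr s / c\<^sup>2)"
    using c_ge_1 by (simp flip: ennreal_mult add: power2_eq_square)
  ultimately show ?thesis using c_ge_1 by simp
qed

text \<open>Turns the quotient of \<open>ennreal\<close> values in \<open>lower_reg_dim\<close> into
  a quotient of positive reals.\<close>

lemma ball_measure_real:
  assumes "x \<in> X" "0 < r" "r \<le> D"
  obtains u where "\<nu> (cball x r \<inter> X) = ennreal u" "r powr s / c \<le> u" "u \<le> c * r powr s" "0 < u"
proof -
  have up: "\<nu> (cball x r \<inter> X) \<le> ennreal (c * r powr s)"
    and lo: "ennreal (r powr s / c) \<le> \<nu> (cball x r \<inter> X)"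
    using assms by (auto intro: upper lower)
  have "0 < r powr s / c" using assms c_ge_1 by simp
  with up lo show thesis
    using c_ge_1 by (cases "\<nu> (cball x r \<inter> X)" rule: ennreal_cases)
      (auto simp: ennreal_le_iff ennreal_le_iff2 top_unique intro!: that)
qed

end

section \<open>The dimensions of bounded Ahlfors regular spaces\<close>

lemma powr_minus_unbounded:
  fixes e K :: real
  assumes "0 < e"
  obtains q where "0 < q" "q < 1" "K < q powr (- e)"
proof -
  define K' where "K' = max K 1 + 1"
  have K': "1 < K'" "K < K'" by (auto simp: K'_def)
  define q where "q = K' powr (- (1 / e))"
  have "0 < q" using K' by (simp add: q_def)
  moreover have "q < 1" unfolding q_def using K' assms by (subst powr_less_one) auto
  moreover have "q powr (- e) = K'" using K' assms by (simp add: q_def powr_powr)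
  ultimately show thesis using that K' by auto
qed

locale bounded_ahlfors_regular = ahlfors_regular +
  assumes ediam_le: "ediam X \<le> ennreal D" and two_points: "\<exists>a\<in>X. \<exists>b\<in>X. a \<noteq> b"
begin

lemma radius_le:
  assumes "0 < R" "ennreal R < ediam X"
  shows "R \<le> D"
proof -
  have "ennreal R < ennreal D" using assms(2) ediam_le by (rule order.strict_trans2)
  then show ?thesis using assms D_pos by (simp add: ennreal_less_iff)
qed

lemma ex_radius:
  obtains a R where "a \<in> X" "0 < R" "ennreal R < ediam X" "R \<le> D"
proof -
  obtain a b where ab: "a \<in> X" "b \<in> X" "a \<noteq> b" using two_points by auto
  then have "ennreal (dist a b) \<le> ediam X"
    unfolding ediam_def by (intro SUP_upper2[of "(a, b)"]) auto
  moreover have "ennreal (dist a b / 2) < ennreal (dist a b)"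
    using ab by (simp add: ennreal_less_iff)
  ultimately have "ennreal (dist a b / 2) < ediam X" by (rule order.strict_trans2[rotated 1])
  moreover have "0 < dist a b / 2" using ab by simp
  ultimately show thesis using that ab(1) radius_le by blast
qed

lemma lower_reg_dim_eq: "lower_reg_dim X \<nu> = ereal s"
proof (rule antisym)
  show "ereal s \<le> lower_reg_dim X \<nu>"
    unfolding lower_reg_dim_def
  proof (rule SUP_upper, simp only: mem_Collect_eq, intro conjI exI[of _ "c\<^sup>2"] ballI allI impI)
    fix x r R assume x: "x \<in> X" and rR: "0 < r \<and> r < R \<and> ennreal R < ediam X"
    then have "R \<le> D" by (intro radius_le) auto
    obtain u where u: "\<nu> (cball x r \<inter> X) = ennreal u" "u \<le> c * r powr s" "0 < u"
      using ball_measure_real[OF x, of r] rR \<open>R \<le> D\<close> by auto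
    obtain v where v: "\<nu> (cball x R \<inter> X) = ennreal v" "R powr s / c \<le> v" "0 < v"
      using ball_measure_real[OF x, of R] rR \<open>R \<le> D\<close> by auto
    have "u / v \<le> (c * r powr s) / (R powr s / c)"
      using u v rR c_ge_1 by (intro frac_le) auto
    also have "\<dots> = c\<^sup>2 * (r / R) powr s"
      using rR c_ge_1 by (simp add: powr_divide power2_eq_square)
    finally show "\<nu> (cball x r \<inter> X) / \<nu> (cball x R \<inter> X) \<le> ennreal (c\<^sup>2 * (r / R) powr s)"
      using u v by (simp add: divide_ennreal ennreal_leI)
  qed (use s_pos c_ge_1 in auto)
  show "lower_reg_dim X \<nu> \<le> ereal s"
    unfolding lower_reg_dim_def
  proof (rule SUP_least)
    fix t :: real
    assume "t \<in> {t. 0 \<le> t \<and> (\<exists>c\<ge>1. \<forall>x\<in>X. \<forall>r R. 0 < r \<and> r < R \<and> ennreal R < ediam X \<longrightarrow>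
        \<nu> (cball x r \<inter> X) / \<nu> (cball x R \<inter> X) \<le> ennreal (c * (r / R) powr t))}"
    then obtain c' where c': "1 \<le> c'" "\<And>x r R. x \<in> X \<Longrightarrow> 0 < r \<Longrightarrow> r < R \<Longrightarrow> ennreal R < ediam X \<Longrightarrow>
        \<nu> (cball x r \<inter> X) / \<nu> (cball x R \<inter> X) \<le> ennreal (c' * (r / R) powr t)"
      by blast
    show "ereal t \<le> ereal s"
    proof (rule ccontr)
      assume "\<not> ?thesis"
      then have "0 < t - s" by simp
      \<comment> \<open>For one center and the radii \<open>q * R < R\<close> the mass ratio is at
        least \<open>q powr s / c\<^sup>2\<close>. An admissible exponent \<open>t\<close> would
        thus keep \<open>q powr (s - t)\<close> below \<open>c\<^sup>2 * c'\<close>, so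
        \<open>q\<close> is chosen to violate this.\<close>
      then obtain q where q: "0 < q" "q < 1" "c\<^sup>2 * c' < q powr (- (t - s))"
        by (rule powr_minus_unbounded)
      obtain a R where R: "a \<in> X" "0 < R" "ennreal R < ediam X" "R \<le> D" by (rule ex_radius)
      have r: "0 < q * R" "q * R < R" using q R by auto
      obtain u where u: "\<nu> (cball a (q * R) \<inter> X) = ennreal u" "(q * R) powr s / c \<le> u" "0 < u"
        using ball_measure_real[OF R(1), of "q * R"] r R by auto
      obtain v where v: "\<nu> (cball a R \<inter> X) = ennreal v" "v \<le> c * R powr s" "0 < v"
        using ball_measure_real[OF R(1), of R] R by auto
      have "ennreal (u / v) \<le> ennreal (c' * q powr t)"
        using c'(2)[OF R(1) r R(3)] u v R by (simp add: divide_ennreal)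
      then have "u / v \<le> c' * q powr t"
        using c'(1) by (simp add: ennreal_le_iff)
      moreover have "((q * R) powr s / c) / (c * R powr s) \<le> u / v"
        using u v R c_ge_1 by (intro frac_le) auto
      moreover have "((q * R) powr s / c) / (c * R powr s) = q powr s / c\<^sup>2"
        using q R by (simp add: powr_mult power2_eq_square)
      ultimately have "q powr s / c\<^sup>2 \<le> c' * q powr t" by simp
      then have "q powr s \<le> c\<^sup>2 * c' * q powr t"
        using c_ge_1 by (simp add: field_simps)
      then have "q powr s / q powr t \<le> c\<^sup>2 * c'"
        using q by (simp add: field_simps)
      then show False using q by (simp add: powr_diff)
    qed
  qed
qed

text \<open>From below: the covering balls must carry the mass of the ball that they cover. From
  above: \<open>covering_bound\<close> supplies an economical cover of one ball, and a small ratio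
  \<open>q\<close> of the radii excludes exponents above \<open>s\<close>.\<close>

lemma lower_dim_eq: "lower_dim X = ereal s"
proof (rule antisym)
  have not_single: "\<not> (\<exists>a. X = {a})" using two_points by auto
  show "ereal s \<le> lower_dim X"
    unfolding lower_dim_def
  proof (rule SUP_upper, simp only: mem_Collect_eq not_single simp_thms,
      intro conjI exI[of _ "1 / c\<^sup>2"] ballI allI impI)
    fix x r R F assume x: "x \<in> X" and rR: "0 < r \<and> r < R \<and> ennreal R < ediam X"
      and F: "F \<subseteq> X" "finite F \<and> cball x R \<inter> X \<subseteq> (\<Union>y\<in>F. cball y r \<inter> X)"
    then have "R \<le> D" by (intro radius_le) auto
    have "ennreal (R powr s / c) \<le> \<nu> (cball x R \<inter> X)"
      using x rR \<open>R \<le> D\<close> by (intro lower) auto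
    also have "\<dots> \<le> \<nu> (\<Union>y\<in>F. cball y r \<inter> X)"
      using F by (intro metric_measure_mono[OF measure]) auto
    also have "\<dots> \<le> (\<Sum>y\<in>F. \<nu> (cball y r \<inter> X))"
      using F by (intro metric_measure_finite_UN[OF measure]) auto
    also have "\<dots> \<le> (\<Sum>y\<in>F. ennreal (c * r powr s))"
      using F rR by (intro sum_mono upper) auto
    also have "\<dots> = ennreal (real (card F) * (c * r powr s))"
      using c_ge_1 by (subst sum_ennreal) auto
    finally have "R powr s / c \<le> real (card F) * (c * r powr s)"
      using c_ge_1 by (subst (asm) ennreal_le_iff) auto
    then have "(R powr s / r powr s) / c\<^sup>2 \<le> real (card F)"
      using c_ge_1 rR by (simp add: field_simps power2_eq_square)
    moreover have "R powr s / r powr s = (r / R) powr (- s)"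
      using rR by (simp add: powr_divide powr_minus_divide)
    ultimately show "1 / c\<^sup>2 * (r / R) powr - s \<le> real (card F)" by simp
  qed (use s_pos c_ge_1 in auto)
  show "lower_dim X \<le> ereal s"
    unfolding lower_dim_def
  proof (rule SUP_least)
    fix t :: real
    assume "t \<in> {t. 0 \<le> t \<and> (\<exists>c>0. \<forall>x\<in>X. \<forall>r R.
        0 < r \<and> r < R \<and> (ennreal R < ediam X \<or> (\<exists>a. X = {a})) \<longrightarrow>
        (\<forall>F\<subseteq>X. finite F \<and> cball x R \<inter> X \<subseteq> (\<Union>y\<in>F. cball y r \<inter> X) \<longrightarrow>
           c * (r / R) powr (- t) \<le> real (card F)))}"
    then obtain c' where c': "0 < c'" "\<forall>x\<in>X. \<forall>r R.
        0 < r \<and> r < R \<and> (ennreal R < ediam X \<or> (\<exists>a. X = {a})) \<longrightarrow>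
        (\<forall>F\<subseteq>X. finite F \<and> cball x R \<inter> X \<subseteq> (\<Union>y\<in>F. cball y r \<inter> X) \<longrightarrow>
           c' * (r / R) powr (- t) \<le> real (card F))"
      unfolding mem_Collect_eq by (elim conjE exE) (rule that)
    show "ereal t \<le> ereal s"
    proof (rule ccontr)
      assume "\<not> ?thesis"
      then have "0 < t - s" by simp
      then obtain q where q: "0 < q" "q < 1" "c\<^sup>2 * 4 powr s / c' < q powr (- (t - s))"
        by (rule powr_minus_unbounded)
      obtain a R where R: "a \<in> X" "0 < R" "ennreal R < ediam X" "R \<le> D" by (rule ex_radius)
      have r: "0 < q * R" "q * R < R" using q R by auto
      obtain F where F: "finite F" "F \<subseteq> X" "cball a R \<inter> X \<subseteq> (\<Union>y\<in>F. cball y (q * R) \<inter> X)"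
          "real (card F) \<le> c\<^sup>2 * (4 * R / (q * R)) powr s"
        using covering_bound[OF R(1), of "q * R" R] r R by auto
      have "c' * q powr (- t) \<le> real (card F)"
        using c'(2)[rule_format, OF R(1), of "q * R" R F] r R F by simp
      also have "\<dots> \<le> c\<^sup>2 * 4 powr s * q powr (- s)"
        using F(4) q R by (simp add: powr_divide powr_minus_divide)
      finally have "q powr (- t) / q powr (- s) \<le> c\<^sup>2 * 4 powr s / c'"
        using q c' by (simp add: field_simps)
      then show False using q by (simp add: powr_diff[symmetric])
    qed
  qed
qed

end

text \<open>Taking \<open>D\<close> as half the distance of two points makes each radius up to
  \<open>D\<close> strictly smaller than the diameter, as \<open>s_regular\<close> demands. For
  larger radii the upper bound follows from the finite total mass \<open>m'\<close>, at the cost of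
  the constant \<open>m' / D powr s\<close>.\<close>

lemma s_regular_imp_ahlfors_regular:
  assumes "s_regular s C" "bounded C"
  obtains \<nu> c D where "ahlfors_regular s c D C \<nu>"
proof -
  obtain \<nu> c where m: "metric_measure C \<nu>" and c: "1 \<le> c" and s: "0 < s"
    and reg: "\<And>x r. x \<in> C \<Longrightarrow> 0 < r \<Longrightarrow> ennreal r < ediam C \<Longrightarrow>
           ennreal (r powr s / c) \<le> \<nu> (cball x r \<inter> C) \<and> \<nu> (cball x r \<inter> C) \<le> ennreal (c * r powr s)"
    using assms(1) unfolding s_regular_def by blast
  obtain a b where ab: "a \<in> C" "b \<in> C" "a \<noteq> b" using assms(1) unfolding s_regular_def by blast
  define D where "D = dist a b / 2"
  have D: "0 < D" using ab by (simp add: D_def)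
  have diam: "ennreal r < ediam C" if "0 < r" "r \<le> D" for r
  proof -
    have "ennreal r < ennreal (dist a b)"
      using that ab by (simp add: D_def ennreal_less_iff)
    also have "\<dots> \<le> ediam C" using ab unfolding ediam_def by (intro SUP_upper2[of "(a, b)"]) auto
    finally show ?thesis .
  qed
  have "\<nu> C < \<infinity>" using m \<open>bounded C\<close> unfolding metric_measure_def by blast
  then obtain m' where m': "\<nu> C = ennreal m'" "0 \<le> m'" by (cases "\<nu> C" rule: ennreal_cases) auto
  define c' where "c' = max c (m' / D powr s)"
  have "ahlfors_regular s c' D C \<nu>"
  proof
    fix x and r :: real assume x: "x \<in> C" and r: "0 < r"
    show "\<nu> (cball x r \<inter> C) \<le> ennreal (c' * r powr s)"
    proof (cases "r \<le> D")
      case True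
      then have "\<nu> (cball x r \<inter> C) \<le> ennreal (c * r powr s)" using reg[OF x r diam[OF r]] by simp
      also have "\<dots> \<le> ennreal (c' * r powr s)"
        by (intro ennreal_leI mult_right_mono) (auto simp: c'_def)
      finally show ?thesis .
    next
      case False
      have "\<nu> (cball x r \<inter> C) \<le> \<nu> C" by (intro metric_measure_mono[OF m]) auto
      also have "\<dots> \<le> ennreal (m' / D powr s * r powr s)"
      proof -
        have "D powr s \<le> r powr s" using False D s by (intro powr_mono2) auto
        then have "m' * D powr s \<le> m' * r powr s" using m'(2) by (rule mult_left_mono)
        then show ?thesis using D m' by (auto simp: field_simps intro!: ennreal_leI)
      qed
      also have "\<dots> \<le> ennreal (c' * r powr s)"
        by (intro ennreal_leI mult_right_mono) (auto simp: c'_def)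
      finally show ?thesis .
    qed
    assume "r \<le> D"
    have "ennreal (r powr s / c') \<le> ennreal (r powr s / c)"
      using c by (intro ennreal_leI divide_left_mono) (auto simp: c'_def)
    also have "\<dots> \<le> \<nu> (cball x r \<inter> C)" using reg[OF x r diam[OF r \<open>r \<le> D\<close>]] by simp
    finally show "ennreal (r powr s / c') \<le> \<nu> (cball x r \<inter> C)" .
  qed (use s c D m in \<open>auto simp: c'_def\<close>)
  then show thesis by (rule that)
qed

section \<open>Similitudes of Euclidean spaces\<close>

lemma similitude_inj:
  assumes "0 < \<rho>" "\<And>x y. dist (f x) (f y) = \<rho> * dist x y"
  shows "inj f"
proof (rule injI)
  fix x y assume "f x = f y"
  then show "x = y" using assms(1) assms(2)[of x y] by simp
qed

text \<open>Normalised to fix \<open>0\<close> and to have ratio \<open>1\<close>, the map is an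
  isometry fixing the origin, hence an orthogonal transformation, hence onto. Surjectivity is what
  makes images of balls full balls.\<close>

lemma similitude_surj:
  fixes f :: "'a::euclidean_space \<Rightarrow> 'a"
  assumes "0 < \<rho>" and sim: "\<And>x y. dist (f x) (f y) = \<rho> * dist x y"
  shows "surj f"
proof -
  define g where "g x = (1 / \<rho>) *\<^sub>R (f x - f 0)" for x
  have "dist (g x) (g y) = dist x y" for x y
  proof -
    have "g x - g y = (1 / \<rho>) *\<^sub>R (f x - f y)" by (simp add: g_def algebra_simps)
    then show ?thesis using sim[of x y] \<open>0 < \<rho>\<close> by (simp add: dist_norm)
  qed
  then have "orthogonal_transformation g"
    by (simp add: orthogonal_transformation_isometry g_def)
  then have "surj g" by (rule orthogonal_transformation_surj)
  moreover have "f x = f 0 + \<rho> *\<^sub>R g x" for x using \<open>0 < \<rho>\<close> by (simp add: g_def)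
  ultimately show ?thesis
    unfolding surj_def
  proof (intro allI)
    fix y
    assume *: "\<And>x. f x = f 0 + \<rho> *\<^sub>R g x"
    obtain x where "g x = (1 / \<rho>) *\<^sub>R (y - f 0)" using \<open>surj g\<close> by (metis surjD)
    then have "y = f x" using *[of x] \<open>0 < \<rho>\<close> by simp
    then show "\<exists>x. y = f x" ..
  qed
qed

lemma similitude_image_ball:
  fixes f :: "'a::euclidean_space \<Rightarrow> 'a"
  assumes "0 < \<rho>" and sim: "\<And>x y. dist (f x) (f y) = \<rho> * dist x y"
  shows "f ` ball x r = ball (f x) (\<rho> * r)"
proof (intro equalityI subsetI)
  fix y assume y: "y \<in> ball (f x) (\<rho> * r)"
  obtain z where "y = f z" using similitude_surj[OF assms] by (metis surjD)
  then show "y \<in> f ` ball x r" using y sim \<open>0 < \<rho>\<close> by auto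
qed (use assms in auto)

lemma similitude_open_image:
  fixes f :: "'a::euclidean_space \<Rightarrow> 'a"
  assumes "0 < \<rho>" and sim: "\<And>x y. dist (f x) (f y) = \<rho> * dist x y" and "open V"
  shows "open (f ` V)"
  unfolding open_contains_ball
proof
  fix y assume "y \<in> f ` V"
  then obtain x where x: "x \<in> V" "y = f x" by auto
  then obtain e where e: "0 < e" "ball x e \<subseteq> V" using \<open>open V\<close> open_contains_ball by blast
  have "ball y (\<rho> * e) \<subseteq> f ` V"
    using image_mono[OF e(2), of f] x(2) similitude_image_ball[OF assms(1,2)] by simp
  then show "\<exists>e>0. ball y e \<subseteq> f ` V" using e(1) \<open>0 < \<rho>\<close> by (intro exI[of _ "\<rho> * e"]) simp
qed

text \<open>The volume count: the disjoint balls have together at most the Lebesgue measure of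
  \<open>ball x b\<close>.\<close>

lemma card_disjoint_balls_le:
  fixes p :: "'b \<Rightarrow> 'a::euclidean_space"
  assumes "finite F" "0 < a" "0 < b" and sub: "\<And>i. i \<in> F \<Longrightarrow> ball (p i) a \<subseteq> ball x b"
    and "disjoint_family_on (\<lambda>i. ball (p i) a) F"
  shows "real (card F) \<le> (b / a) ^ DIM('a)"
proof -
  let ?v = "measure lborel (ball (0 :: 'a) 1)"
  have "?v > 0" by (simp add: content_ball_pos)
  have "real (card F) * (a ^ DIM('a) * ?v) = (\<Sum>i\<in>F. measure lborel (ball (p i) a))"
    using \<open>0 < a\<close> by (subst content_ball_conv_unit_ball) auto
  also have "\<dots> = measure lborel (\<Union>i\<in>F. ball (p i) a)"
    using assms emeasure_lborel_ball_finite by (intro measure_finite_Union[symmetric]) (auto simp: less_top)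
  also have "\<dots> \<le> measure lborel (ball x b)"
    using sub \<open>finite F\<close> emeasure_lborel_ball_finite[of x b]
    by (intro measure_mono_fmeasurable fmeasurableI) (auto intro!: sets.finite_UN)
  also have "\<dots> = b ^ DIM('a) * ?v"
    using \<open>0 < b\<close> by (subst content_ball_conv_unit_ball) auto
  finally show ?thesis using \<open>?v > 0\<close> \<open>0 < a\<close> by (simp add: power_divide field_simps)
qed

text \<open>Each \<open>\<phi> i\<close> maps \<open>V\<close> into itself, so it multiplies
  distances to \<open>V\<close> by at most \<open>r\<close>. A point of \<open>K\<close> traced back
  \<open>n\<close> times either meets \<open>B\<close>, which lies in \<open>V\<close>, or has
  distance at most \<open>r ^ n\<close> times a bound valid on all of \<open>K\<close>.\<close>

lemma attractor_subset:
  fixes K V :: "'a::heine_borel set"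
  assumes "bounded K" and K: "K \<subseteq> (\<Union>i\<in>I. \<phi> i ` K) \<union> B"
    and V: "closed V" "V \<noteq> {}" "B \<subseteq> V" "\<And>i. i \<in> I \<Longrightarrow> \<phi> i ` V \<subseteq> V"
    and "0 \<le> r" "r < 1" and lip: "\<And>i x y. i \<in> I \<Longrightarrow> dist (\<phi> i x) (\<phi> i y) \<le> r * dist x y"
  shows "K \<subseteq> V"
proof -
  obtain v where "v \<in> V" using V by auto
  obtain T where *: "\<And>x. x \<in> K \<Longrightarrow> dist v x \<le> T" using \<open>bounded K\<close> bounded_any_center by metis
  then have T: "infdist x V \<le> T" if "x \<in> K" for x
    using *[OF that] \<open>v \<in> V\<close> by (intro infdist_le2[of v]) (simp_all add: dist_commute[of x v])
  have contract: "infdist (\<phi> i x) V \<le> r * infdist x V" if i: "i \<in> I" for i x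
  proof -
    obtain y where y: "y \<in> V" "infdist x V = dist x y"
      by (rule infdist_attains_inf[OF V(1,2)])
    have "infdist (\<phi> i x) V \<le> dist (\<phi> i x) (\<phi> i y)" using V(4)[OF i] y by (intro infdist_le) auto
    also have "\<dots> \<le> r * infdist x V" using lip[OF i] y by simp
    finally show ?thesis .
  qed
  have iter: "infdist x V \<le> r ^ n * max T 0" if "x \<in> K" for x n
    using that
  proof (induction n arbitrary: x)
    case 0
    then show ?case using T[of x] by simp
  next
    case (Suc n)
    then consider "x \<in> B" | i y where "i \<in> I" "y \<in> K" "x = \<phi> i y" using K by blast
    then show ?case
    proof cases
      case 1
      then show ?thesis using V \<open>0 \<le> r\<close> by auto
    next
      case 2
      have "infdist x V \<le> r * infdist y V" using contract 2 by simp
      also have "\<dots> \<le> r * (r ^ n * max T 0)" using Suc.IH 2 \<open>0 \<le> r\<close> by (intro mult_left_mono) auto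
      finally show ?thesis by (simp add: mult.assoc)
    qed
  qed
  have "x \<in> V" if "x \<in> K" for x
  proof -
    have "(\<lambda>n. r ^ n * max T 0) \<longlonglongrightarrow> 0 * max T 0"
      using \<open>0 \<le> r\<close> \<open>r < 1\<close> by (intro tendsto_mult_right LIMSEQ_realpow_zero) auto
    then have "infdist x V \<le> 0" using iter[OF that] by (intro LIMSEQ_le_const) auto
    then show ?thesis using V infdist_nonneg[of x V] in_closed_iff_infdist_zero[of V x] by simp
  qed
  then show ?thesis by blast
qed

section \<open>Iterated function systems with the condensation open set condition\<close>

text \<open>Beyond the condensation open set condition, \<open>U\<close> is bounded, so that the
  copies of \<open>U\<close> have diameters comparable to their ratios;
  \<open>condensation_open_set_bounded\<close> provides such a set.\<close>

locale condensation_system =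
  fixes I :: "'i set" and \<phi> :: "'i \<Rightarrow> 'a::euclidean_space \<Rightarrow> 'a" and \<rho> :: "'i \<Rightarrow> real"
    and C U :: "'a set"
  assumes finite_I: "finite I" and I_nonempty: "I \<noteq> {}"
    and \<rho>_pos: "i \<in> I \<Longrightarrow> 0 < \<rho> i" and \<rho>_less_1: "i \<in> I \<Longrightarrow> \<rho> i < 1"
    and similitude: "i \<in> I \<Longrightarrow> dist (\<phi> i x) (\<phi> i y) = \<rho> i * dist x y"
    and compact_C: "compact C" and C_nonempty: "C \<noteq> {}"
    and open_U: "open U" and bounded_U: "bounded U"
    and C_subset: "C \<subseteq> U" and C_disjoint: "i \<in> I \<Longrightarrow> C \<inter> closure (\<phi> i ` U) = {}"
    and image_U: "i \<in> I \<Longrightarrow> \<phi> i ` U \<subseteq> U"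
    and disjoint_U: "i \<in> I \<Longrightarrow> j \<in> I \<Longrightarrow> i \<noteq> j \<Longrightarrow> \<phi> i ` U \<inter> \<phi> j ` U = {}"
begin

definition "rmin = Min (\<rho> ` I)"
definition "rmax = Max (\<rho> ` I)"
definition "wratio w = prod_list (map \<rho> w)"

text \<open>The first letter is the outermost map, so the image under \<open>wmap (i # w)\<close>
  lies in the image of \<open>\<phi> i\<close>, and inductions on words peel off the map applied
  last.\<close>

abbreviation "wmap \<equiv> foldr \<phi>"

lemma wratio_simps [simp]: "wratio [] = 1" "wratio (i # w) = \<rho> i * wratio w"
  by (simp_all add: wratio_def)

lemma rmin: "0 < rmin" "i \<in> I \<Longrightarrow> rmin \<le> \<rho> i" "rmin < 1"
proof -
  have "rmin \<in> \<rho> ` I" unfolding rmin_def using finite_I I_nonempty by (intro Min_in) auto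
  then show "0 < rmin" "rmin < 1" using \<rho>_pos \<rho>_less_1 by auto
qed (use finite_I in \<open>simp add: rmin_def\<close>)

lemma rmax: "0 < rmax" "i \<in> I \<Longrightarrow> \<rho> i \<le> rmax" "rmax < 1"
proof -
  have "rmax \<in> \<rho> ` I" unfolding rmax_def using finite_I I_nonempty by (intro Max_in) auto
  then show "0 < rmax" "rmax < 1" using \<rho>_pos \<rho>_less_1 by auto
qed (use finite_I in \<open>simp add: rmax_def\<close>)

lemma wratio_pos: "w \<in> lists I \<Longrightarrow> 0 < wratio w"
  by (induction w) (auto simp: \<rho>_pos)

lemma wmap_similitude: "w \<in> lists I \<Longrightarrow> dist (wmap w x) (wmap w y) = wratio w * dist x y"
  by (induction w) (auto simp: similitude)

lemma wmap_image_Cons: "wmap (i # w) ` A = \<phi> i ` wmap w ` A"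
  by (auto simp: image_image)

lemma wmap_image_subset:
  assumes "\<And>i. i \<in> I \<Longrightarrow> \<phi> i ` A \<subseteq> A" "w \<in> lists I"
  shows "wmap w ` A \<subseteq> A"
  using assms(2)
proof (induction w)
  case (Cons i w)
  then show ?case using assms(1)[of i] unfolding wmap_image_Cons by blast
qed simp

lemma wmap_U: "w \<in> lists I \<Longrightarrow> wmap w ` U \<subseteq> U"
  using image_U by (rule wmap_image_subset)

lemma hausdorff_measure_wmap:
  "0 < s \<Longrightarrow> w \<in> lists I \<Longrightarrow>
    hausdorff_measure s (wmap w ` A) = ennreal (wratio w powr s) * hausdorff_measure s A"
  by (intro hausdorff_measure_similitude_image wmap_similitude wratio_pos)

lemma continuous_\<phi>: "i \<in> I \<Longrightarrow> continuous_on A (\<phi> i)"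
  unfolding continuous_on_iff
proof (intro ballI allI impI)
  fix x and e :: real assume "i \<in> I" "x \<in> A" "0 < e"
  then show "\<exists>d>0. \<forall>x'\<in>A. dist x' x < d \<longrightarrow> dist (\<phi> i x') (\<phi> i x) < e"
    using \<rho>_pos[of i] by (intro exI[of _ "e / \<rho> i"]) (auto simp: similitude field_simps)
qed

lemma image_closure_U: "i \<in> I \<Longrightarrow> \<phi> i ` closure U \<subseteq> closure (\<phi> i ` U)"
  by (intro image_closure_subset continuous_\<phi>) (auto simp: closure_subset)

lemma open_image_U: "i \<in> I \<Longrightarrow> open (\<phi> i ` U)"
  by (rule similitude_open_image[OF \<rho>_pos similitude open_U])

text \<open>Locates both attractors: with \<open>B = {}\<close> for \<open>E\<close>, with
  \<open>B = C\<close> for \<open>EC\<close>.\<close>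

lemma subset_closure_U:
  assumes "bounded K" "K \<subseteq> (\<Union>i\<in>I. \<phi> i ` K) \<union> B" "B \<subseteq> closure U"
  shows "K \<subseteq> closure U"
proof (rule attractor_subset[OF assms(1,2)])
  show "closure U \<noteq> {}" using C_nonempty C_subset by auto
  show "\<phi> i ` closure U \<subseteq> closure U" if "i \<in> I" for i
    using image_closure_U[OF that] closure_mono[OF image_U[OF that]] by blast
  show "dist (\<phi> i x) (\<phi> i y) \<le> rmax * dist x y" if "i \<in> I" for i x y
    using rmax(2)[OF that] by (simp add: similitude[OF that] mult_right_mono)
qed (use assms rmax in auto)

subsection \<open>Stopping words\<close>

text \<open>Properties of the usual cut set, the words stopped as soon as their ratio is at most
  \<open>\<delta>\<close>. The last letter shrinks by no more than \<open>rmin\<close>, which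
  explains the lower bound.\<close>

definition "stopping_set \<delta> W \<longleftrightarrow> finite W \<and> W \<subseteq> lists I \<and>
  (\<forall>w\<in>W. rmin * \<delta> \<le> wratio w \<and> wratio w \<le> \<delta>) \<and>
  (\<forall>v\<in>W. \<forall>w\<in>W. v \<noteq> w \<longrightarrow> wmap v ` U \<inter> wmap w ` U = {})"

text \<open>Recursion on the first letter: the words for \<open>\<delta> < 1\<close> are
  \<open>i # v\<close> with \<open>v\<close> among the words for \<open>\<delta> / \<rho> i\<close>.
  These scales may exceed \<open>1\<close> but not \<open>1 / rmin\<close>, and from
  \<open>1\<close> on the empty word alone suffices; this fixes the range of
  \<open>\<delta>\<close>. All properties appear in one statement because they concern the same
  \<open>W\<close>.\<close>

lemma ex_stopping_set:
  fixes s :: real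
  assumes "0 < \<delta>" "\<delta> \<le> 1 / rmin"
  shows "\<exists>W. stopping_set \<delta> W \<and>
    (1 \<le> (\<Sum>i\<in>I. \<rho> i powr s) \<longrightarrow> 1 \<le> (\<Sum>w\<in>W. wratio w powr s)) \<and>
    (\<forall>K B. K \<subseteq> (\<Union>i\<in>I. \<phi> i ` K) \<union> B \<longrightarrow>
      (\<forall>x\<in>K. (\<exists>w\<in>W. x \<in> wmap w ` K) \<or> (\<exists>w\<in>lists I. \<delta> < wratio w \<and> x \<in> wmap w ` B)))"
    (is "\<exists>W. ?P \<delta> W")
proof -
  have base: "\<exists>W. ?P \<delta> W" if "1 \<le> \<delta>" "\<delta> \<le> 1 / rmin" for \<delta>
    using that rmin by (intro exI[of _ "{[]}"]) (auto simp: stopping_set_def field_simps)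
  have step: "\<exists>W. ?P \<delta> W"
    if \<delta>: "0 < \<delta>" "\<delta> < 1" and ex: "\<And>i. i \<in> I \<Longrightarrow> \<exists>W. ?P (\<delta> / \<rho> i) W" for \<delta>
  proof -
    obtain V where V: "\<And>i. i \<in> I \<Longrightarrow> ?P (\<delta> / \<rho> i) (V i)" using ex by metis
    have st: "stopping_set (\<delta> / \<rho> i) (V i)" if "i \<in> I" for i using V[OF that] by blast
    have words: "v \<in> lists I" "rmin * \<delta> \<le> \<rho> i * wratio v" "\<rho> i * wratio v \<le> \<delta>" "wmap v ` U \<subseteq> U"
      if "i \<in> I" "v \<in> V i" for i v
      using st[OF that(1)] that \<rho>_pos[of i] wmap_U[of v] by (auto simp: stopping_set_def field_simps)
    define W where "W = (\<Union>i\<in>I. (#) i ` V i)"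
    have disj: "wmap v ` U \<inter> wmap w ` U = {}" if vw: "v \<in> W" "w \<in> W" "v \<noteq> w" for v w
    proof -
      obtain i v' where v: "i \<in> I" "v' \<in> V i" "v = i # v'" using vw by (auto simp: W_def)
      obtain j w' where w: "j \<in> I" "w' \<in> V j" "w = j # w'" using vw by (auto simp: W_def)
      show ?thesis
      proof (cases "i = j")
        case True
        then have "wmap v' ` U \<inter> wmap w' ` U = {}"
          using st[OF v(1)] v w vw by (auto simp: stopping_set_def)
        then have "\<phi> i ` wmap v' ` U \<inter> \<phi> i ` wmap w' ` U = {}"
          using similitude_inj[OF \<rho>_pos similitude, OF v(1) v(1)] by (metis image_Int image_empty)
        then show ?thesis using v w True unfolding v(3) w(3) wmap_image_Cons by simp
      next
        case False
        then show ?thesis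
          using disjoint_U[OF v(1) w(1)] image_mono[OF words(4)[OF v(1,2)], of "\<phi> i"]
            image_mono[OF words(4)[OF w(1,2)], of "\<phi> j"]
          unfolding v(3) w(3) wmap_image_Cons by blast
      qed
    qed
    have "finite W" using finite_I st by (auto simp: W_def stopping_set_def)
    moreover have "W \<subseteq> lists I" using words(1) by (force simp: W_def)
    moreover have "\<forall>w\<in>W. rmin * \<delta> \<le> wratio w \<and> wratio w \<le> \<delta>" using words by (auto simp: W_def)
    ultimately have "stopping_set \<delta> W" using disj by (simp add: stopping_set_def)
    moreover have "1 \<le> (\<Sum>w\<in>W. wratio w powr s)" if le: "1 \<le> (\<Sum>i\<in>I. \<rho> i powr s)"
    proof -
      have "(\<Sum>w\<in>W. wratio w powr s) = (\<Sum>i\<in>I. \<Sum>w\<in>(#) i ` V i. wratio w powr s)"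
        unfolding W_def using finite_I st by (intro sum.UNION_disjoint) (auto simp: stopping_set_def)
      also have "\<dots> = (\<Sum>i\<in>I. \<Sum>w\<in>V i. \<rho> i powr s * wratio w powr s)"
      proof (rule sum.cong)
        fix i assume i: "i \<in> I"
        have "(\<Sum>w\<in>(#) i ` V i. wratio w powr s) = (\<Sum>w\<in>V i. (\<rho> i * wratio w) powr s)"
          by (subst sum.reindex) auto
        also have "\<dots> = (\<Sum>w\<in>V i. \<rho> i powr s * wratio w powr s)"
          using words(1)[OF i] \<rho>_pos[OF i] wratio_pos
          by (intro sum.cong refl powr_mult)
        finally show "(\<Sum>w\<in>(#) i ` V i. wratio w powr s) = (\<Sum>w\<in>V i. \<rho> i powr s * wratio w powr s)" .
      qed simp
      also have "\<dots> \<ge> (\<Sum>i\<in>I. \<rho> i powr s * 1)"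
        unfolding sum_distrib_left[symmetric] using V le by (intro sum_mono mult_left_mono) auto
      finally show ?thesis using le by simp
    qed
    moreover have "(\<exists>w\<in>W. x \<in> wmap w ` K) \<or> (\<exists>w\<in>lists I. \<delta> < wratio w \<and> x \<in> wmap w ` B)"
      if K: "K \<subseteq> (\<Union>i\<in>I. \<phi> i ` K) \<union> B" and "x \<in> K" for K B x
    proof -
      consider "x \<in> B" | i y where "i \<in> I" "y \<in> K" "x = \<phi> i y" using K \<open>x \<in> K\<close> by blast
      then show ?thesis
      proof cases
        case 1
        \<comment> \<open>The empty word serves, since its ratio \<open>1\<close> exceeds
          \<open>\<delta>\<close>.\<close>
        then show ?thesis using \<delta> by (intro disjI2 bexI[of _ "[]"]) auto
      next
        case 2
        then have "(\<exists>w\<in>V i. y \<in> wmap w ` K) \<or> (\<exists>w\<in>lists I. \<delta> / \<rho> i < wratio w \<and> y \<in> wmap w ` B)"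
          using V[OF 2(1)] K by blast
        then show ?thesis
        proof (elim disjE bexE conjE)
          fix w assume "w \<in> V i" "y \<in> wmap w ` K"
          then have "i # w \<in> W" "x \<in> wmap (i # w) ` K"
            unfolding wmap_image_Cons using 2 by (auto simp: W_def)
          then show ?thesis by blast
        next
          fix w assume w: "w \<in> lists I" "\<delta> / \<rho> i < wratio w" "y \<in> wmap w ` B"
          then have "i # w \<in> lists I" "\<delta> < wratio (i # w)" "x \<in> wmap (i # w) ` B"
            unfolding wmap_image_Cons using 2 \<rho>_pos[OF 2(1)] by (auto simp: field_simps)
          then show ?thesis by blast
        qed
      qed
    qed
    ultimately show ?thesis by (intro exI[of _ W]) simp
  qed
  \<comment> \<open>Passing from \<open>\<delta>\<close> to \<open>\<delta> / \<rho> i\<close> gains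
    at least the factor \<open>1 / rmax\<close>, so \<open>n\<close> bounds the number of letters
    until the scale reaches \<open>1\<close>.\<close>
  have "\<exists>W. ?P \<delta> W" if "rmax ^ n \<le> \<delta>" "\<delta> \<le> 1 / rmin" for n \<delta>
    using that
  proof (induction n arbitrary: \<delta>)
    case 0
    then show ?case by (intro base) auto
  next
    case (Suc n)
    show ?case
    proof (cases "1 \<le> \<delta>")
      case True
      then show ?thesis using Suc.prems by (intro base)
    next
      case False
      have "0 < \<delta>" using Suc.prems(1) rmax(1) by (meson less_le_trans zero_less_power)
      show ?thesis
      proof (rule step[OF \<open>0 < \<delta>\<close>])
        fix i assume i: "i \<in> I"
        have "rmax ^ n \<le> \<delta> / rmax" using Suc.prems(1) rmax(1) by (simp add: field_simps)
        also have "\<dots> \<le> \<delta> / \<rho> i" using rmax \<rho>_pos i \<open>0 < \<delta>\<close> by (intro divide_left_mono) auto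
        finally have "rmax ^ n \<le> \<delta> / \<rho> i" .
        moreover have "\<delta> / \<rho> i \<le> 1 / rmin" using rmin i False \<rho>_pos \<open>0 < \<delta>\<close> by (intro frac_le) auto
        ultimately show "\<exists>W. ?P (\<delta> / \<rho> i) W" by (rule Suc.IH)
      qed (use False in simp)
    qed
  qed
  moreover obtain n where "rmax ^ n < \<delta>" using real_arch_pow_inv[OF assms(1) rmax(3)] by blast
  ultimately show ?thesis using assms(2) by (metis less_imp_le)
qed

text \<open>Stated for all \<open>K\<close> and \<open>B\<close>, so that it serves \<open>E\<close>
  with \<open>B = {}\<close>, where the second alternative is void, and \<open>EC\<close> with
  \<open>B = C\<close>.\<close>

definition "stopping_cover \<delta> W \<longleftrightarrow> (\<forall>K B. K \<subseteq> (\<Union>i\<in>I. \<phi> i ` K) \<union> B \<longrightarrow>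
  (\<forall>x\<in>K. (\<exists>w\<in>W. x \<in> wmap w ` K) \<or> (\<exists>w\<in>lists I. \<delta> < wratio w \<and> x \<in> wmap w ` B)))"

lemma stopping_coverE:
  assumes "stopping_cover \<delta> W" "K \<subseteq> (\<Union>i\<in>I. \<phi> i ` K) \<union> B" "x \<in> K"
  obtains w where "w \<in> W" "x \<in> wmap w ` K" | w where "w \<in> lists I" "\<delta> < wratio w" "x \<in> wmap w ` B"
  using assms(1)[unfolded stopping_cover_def, rule_format, OF assms(2,3)] that by blast

lemma stopping_words:
  fixes s :: real
  assumes "0 < \<delta>" "\<delta> \<le> 1"
  obtains W where "stopping_set \<delta> W" "stopping_cover \<delta> W"
    "1 \<le> (\<Sum>i\<in>I. \<rho> i powr s) \<Longrightarrow> 1 \<le> (\<Sum>w\<in>W. wratio w powr s)"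
proof -
  have "1 \<le> 1 / rmin" using rmin by simp
  then have "\<delta> \<le> 1 / rmin" using assms(2) by linarith
  from ex_stopping_set[OF assms(1) this, of s]
  obtain W where "stopping_set \<delta> W \<and>
      (1 \<le> (\<Sum>i\<in>I. \<rho> i powr s) \<longrightarrow> 1 \<le> (\<Sum>w\<in>W. wratio w powr s)) \<and> stopping_cover \<delta> W"
    unfolding stopping_cover_def[symmetric] ..
  then show thesis by (intro that[of W]) simp_all
qed

subsection \<open>Counting\<close>

text \<open>At scale \<open>\<delta>\<close> the disjoint copies of \<open>U\<close> contain balls
  of radius \<open>rmin * \<delta> * \<eta>\<close>, and those counted lie in a ball of radius
  proportional to \<open>\<delta>\<close>. The quotient of the radii, hence \<open>M\<close>, is
  independent of \<open>\<delta>\<close>, \<open>W\<close> and \<open>x\<close>.\<close>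

lemma stopping_set_count:
  assumes "0 < A"
  obtains M :: real where "0 < M"
    "\<And>\<delta> W x. 0 < \<delta> \<Longrightarrow> stopping_set \<delta> W \<Longrightarrow>
      real (card {w\<in>W. wmap w ` closure U \<inter> cball x (A * \<delta>) \<noteq> {}}) \<le> M"
proof -
  obtain u where u: "u \<in> U" using C_nonempty C_subset by blast
  then obtain \<eta> where \<eta>: "0 < \<eta>" "ball u \<eta> \<subseteq> U" using open_U open_contains_ball by blast
  define d where "d = diameter (closure U)"
  have d: "dist x y \<le> d" if "x \<in> closure U" "y \<in> closure U" for x y
    using that bounded_U unfolding d_def by (intro diameter_bounded_bound) auto
  have "0 \<le> d" using d[of u u] u closure_subset by auto
  \<comment> \<open>In units of \<open>\<delta>\<close>: the radius of the given ball, the diameter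
    of a copy meeting it, and the radius of the ball inside that copy.\<close>
  define b where "b = A + d + rmin * \<eta>"
  have "0 < b" using assms \<open>0 \<le> d\<close> rmin(1) \<eta>(1) by (simp add: b_def add_nonneg_pos)
  show thesis
  proof (rule that[of "(b / (rmin * \<eta>)) ^ DIM('a)"])
    show "0 < (b / (rmin * \<eta>)) ^ DIM('a)" using \<open>0 < b\<close> rmin(1) \<eta>(1) by simp
    fix \<delta> W x assume \<delta>: "0 < \<delta>" and st: "stopping_set \<delta> W"
    let ?F = "{w\<in>W. wmap w ` closure U \<inter> cball x (A * \<delta>) \<noteq> {}}"
    have ball_w: "ball (wmap w u) (rmin * \<delta> * \<eta>) \<subseteq> wmap w ` U" if "w \<in> W" for w
    proof -
      have w: "w \<in> lists I" "rmin * \<delta> \<le> wratio w" using st that by (auto simp: stopping_set_def)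
      have "ball (wmap w u) (rmin * \<delta> * \<eta>) \<subseteq> ball (wmap w u) (wratio w * \<eta>)"
        using w(2) \<eta>(1) by (intro subset_ball mult_right_mono) auto
      also have "\<dots> = wmap w ` ball u \<eta>"
        using similitude_image_ball[OF wratio_pos wmap_similitude, OF w(1) w(1)] by simp
      finally show ?thesis using \<eta>(2) by blast
    qed
    have "real (card ?F) \<le> ((b * \<delta>) / (rmin * \<delta> * \<eta>)) ^ DIM('a)"
    proof (rule card_disjoint_balls_le[where p = "\<lambda>w. wmap w u" and x = x])
      show "finite ?F" using st by (simp add: stopping_set_def)
      show "disjoint_family_on (\<lambda>w. ball (wmap w u) (rmin * \<delta> * \<eta>)) ?F"
        unfolding disjoint_family_on_def
      proof (intro ballI impI)
        fix v w assume "v \<in> ?F" "w \<in> ?F" "v \<noteq> w"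
        then have "wmap v ` U \<inter> wmap w ` U = {}" using st by (simp add: stopping_set_def)
        then show "ball (wmap v u) (rmin * \<delta> * \<eta>) \<inter> ball (wmap w u) (rmin * \<delta> * \<eta>) = {}"
          using ball_w[of v] ball_w[of w] \<open>v \<in> ?F\<close> \<open>w \<in> ?F\<close> by blast
      qed
      fix w assume w: "w \<in> ?F"
      then have wl: "w \<in> lists I" "wratio w \<le> \<delta>" using st by (auto simp: stopping_set_def)
      obtain y where y: "y \<in> closure U" "dist x (wmap w y) \<le> A * \<delta>" using w by auto
      have "dist (wmap w y) (wmap w u) \<le> \<delta> * d"
        unfolding wmap_similitude[OF wl(1)]
        using d[OF y(1)] u closure_subset wl(2) wratio_pos[OF wl(1)] \<open>0 \<le> d\<close>
        by (intro mult_mono) auto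
      then have "dist x (wmap w u) \<le> A * \<delta> + \<delta> * d"
        using y(2) dist_triangle[of x "wmap w u" "wmap w y"] by linarith
      then have "dist x (wmap w u) + rmin * \<delta> * \<eta> \<le> b * \<delta>" by (simp add: b_def algebra_simps)
      then show "ball (wmap w u) (rmin * \<delta> * \<eta>) \<subseteq> ball x (b * \<delta>)"
        using ball_subset_ball_iff[of "wmap w u" "rmin * \<delta> * \<eta>" x "b * \<delta>"] by (simp add: dist_commute)
    qed (use rmin \<delta> \<eta> \<open>0 < b\<close> in auto)
    also have "(b * \<delta>) / (rmin * \<delta> * \<eta>) = b / (rmin * \<eta>)" using \<delta> by simp
    finally show "real (card ?F) \<le> (b / (rmin * \<eta>)) ^ DIM('a)" .
  qed
qed

text \<open>The weights \<open>wratio w powr s\<close> sum up to at least \<open>1\<close> and are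
  at most \<open>\<delta> powr s\<close>, so there are at least \<open>\<delta> powr (- s)\<close>
  words. Each has a point of \<open>E\<close> in its piece, hence is counted at some covering ball,
  and each ball counts at most \<open>M\<close> words.\<close>

lemma attractor_cover_count:
  assumes E: "bounded E" "E \<noteq> {}" "E = (\<Union>i\<in>I. \<phi> i ` E)"
    and s: "0 < s" "1 \<le> (\<Sum>i\<in>I. \<rho> i powr s)" and "0 < A"
  obtains M :: real where "0 < M"
    "\<And>\<delta> F. 0 < \<delta> \<Longrightarrow> \<delta> \<le> 1 \<Longrightarrow> finite F \<Longrightarrow> E \<subseteq> (\<Union>y\<in>F. cball y (A * \<delta>)) \<Longrightarrow>
      \<delta> powr (- s) \<le> M * real (card F)"
proof -
  obtain M where M: "0 < M" "\<And>\<delta> W x. 0 < \<delta> \<Longrightarrow> stopping_set \<delta> W \<Longrightarrow>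
      real (card {w\<in>W. wmap w ` closure U \<inter> cball x (A * \<delta>) \<noteq> {}}) \<le> M"
    by (rule stopping_set_count[OF \<open>0 < A\<close>]) blast
  show thesis
  proof (rule that[OF M(1)])
    fix \<delta> F assume \<delta>: "0 < \<delta>" "\<delta> \<le> 1" and F: "finite F" "E \<subseteq> (\<Union>y\<in>F. cball y (A * \<delta>))"
    obtain W where W: "stopping_set \<delta> W" "1 \<le> (\<Sum>w\<in>W. wratio w powr s)"
      using stopping_words[OF \<delta>, of s] s(2) by blast
    have "1 \<le> (\<Sum>w\<in>W. \<delta> powr s)"
      using W(1) s(1) by (intro order_trans[OF W(2)] sum_mono powr_mono2)
        (auto simp: stopping_set_def intro: less_imp_le[OF wratio_pos])
    then have "\<delta> powr (- s) \<le> real (card W)"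
      using \<delta>(1) by (simp add: powr_minus_divide field_simps)
    also have "\<dots> \<le> real (\<Sum>y\<in>F. card {w\<in>W. wmap w ` closure U \<inter> cball y (A * \<delta>) \<noteq> {}})"
    proof -
      have "W \<subseteq> (\<Union>y\<in>F. {w\<in>W. wmap w ` closure U \<inter> cball y (A * \<delta>) \<noteq> {}})"
      proof
        fix w assume w: "w \<in> W"
        obtain e where e: "e \<in> E" using E(2) by auto
        have "wmap w ` E \<subseteq> E"
          using W(1) w E(3) by (intro wmap_image_subset) (auto simp: stopping_set_def)
        then obtain y where "y \<in> F" "wmap w e \<in> cball y (A * \<delta>)" using F(2) e by blast
        moreover have "e \<in> closure U"
          using subset_closure_U[OF E(1), of "{}"] E(3) e by auto
        ultimately show "w \<in> (\<Union>y\<in>F. {w\<in>W. wmap w ` closure U \<inter> cball y (A * \<delta>) \<noteq> {}})"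
          using w by blast
      qed
      then have "card W \<le> card (\<Union>y\<in>F. {w\<in>W. wmap w ` closure U \<inter> cball y (A * \<delta>) \<noteq> {}})"
        using F(1) W(1) by (intro card_mono) (auto simp: stopping_set_def)
      also have "\<dots> \<le> (\<Sum>y\<in>F. card {w\<in>W. wmap w ` closure U \<inter> cball y (A * \<delta>) \<noteq> {}})"
        by (rule card_UN_le[OF F(1)])
      finally show ?thesis by (simp only: of_nat_le_iff)
    qed
    also have "\<dots> \<le> (\<Sum>y\<in>F. M)"
      unfolding of_nat_sum using M(2)[OF \<delta>(1) W(1)] by (intro sum_mono)
    finally show "\<delta> powr (- s) \<le> M * real (card F)" by (simp add: mult.commute)
  qed
qed

text \<open>The ball of radius \<open>R\<close> around \<open>x\<close> contains a piece of
  \<open>E\<close> with ratio comparable to \<open>R\<close>. Pulled back by its word map, a cover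
  with radius \<open>r\<close> becomes a cover of \<open>E\<close> with radius comparable to
  \<open>r / R\<close>, to which \<open>attractor_cover_count\<close> applies.\<close>

lemma lower_dim_attractor_ge:
  assumes E: "compact E" "E \<noteq> {}" "E = (\<Union>i\<in>I. \<phi> i ` E)"
    and s: "0 < s" "1 \<le> (\<Sum>i\<in>I. \<rho> i powr s)"
  shows "ereal s \<le> lower_dim E"
proof -
  have "bounded E" using E(1) by (rule compact_imp_bounded)
  note count = attractor_cover_count[OF this E(2,3) s]
  \<comment> \<open>A one-point set is covered by one ball at every scale, against the count. This
    removes the clause for one-point sets in \<open>lower_dim\<close> and makes \<open>D\<close>
    positive.\<close>
  have not_single: "\<not> (\<exists>a. E = {a})"
  proof
    assume "\<exists>a. E = {a}"
    then obtain a where a: "E = {a}" ..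
    obtain M where M: "0 < M" "\<And>\<delta> F. 0 < \<delta> \<Longrightarrow> \<delta> \<le> 1 \<Longrightarrow> finite F \<Longrightarrow> E \<subseteq> (\<Union>y\<in>F. cball y (1 * \<delta>)) \<Longrightarrow>
      \<delta> powr (- s) \<le> M * real (card F)"
      by (rule count[OF zero_less_one]) blast
    obtain q where q: "0 < q" "q < 1" "M < q powr (- s)" using powr_minus_unbounded[OF s(1)] .
    then show False using M(2)[of q "{a}"] a by simp
  qed
  define D where "D = diameter E"
  have D: "dist x y \<le> D" if "x \<in> E" "y \<in> E" for x y
    unfolding D_def using that \<open>bounded E\<close> by (intro diameter_bounded_bound)
  have ediam: "ediam E \<le> ennreal D"
    unfolding ediam_def by (rule SUP_least) (auto intro!: ennreal_leI D)
  have "0 < D"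
  proof -
    obtain a b where "a \<in> E" "b \<in> E" "a \<noteq> b" using not_single E(2) by blast
    then show ?thesis using D[of a b] by (meson less_le_trans zero_less_dist_iff)
  qed
  \<comment> \<open>The factor \<open>2\<close> pays for the new centers \<open>z y\<close>, and
    \<open>D / rmin\<close> for the ratio of \<open>w\<close>, which may be as small as
    \<open>rmin * (R / D)\<close>.\<close>
  define A where "A = 2 * D / rmin"
  have "0 < A" using \<open>0 < D\<close> rmin(1) by (simp add: A_def)
  obtain M where M: "0 < M" "\<And>\<delta> F. 0 < \<delta> \<Longrightarrow> \<delta> \<le> 1 \<Longrightarrow> finite F \<Longrightarrow> E \<subseteq> (\<Union>y\<in>F. cball y (A * \<delta>)) \<Longrightarrow>
      \<delta> powr (- s) \<le> M * real (card F)"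
    by (rule count[OF \<open>0 < A\<close>]) blast
  show ?thesis
    unfolding lower_dim_def
  proof (rule SUP_upper, simp only: mem_Collect_eq not_single simp_thms,
      intro conjI exI[of _ "1 / M"] ballI allI impI)
    fix x r R F assume x: "x \<in> E" and rR: "0 < r \<and> r < R \<and> ennreal R < ediam E"
      and F: "F \<subseteq> E" "finite F \<and> cball x R \<inter> E \<subseteq> (\<Union>y\<in>F. cball y r \<inter> E)"
    have "ennreal R < ennreal D" using rR ediam by (auto intro: order.strict_trans2)
    then have "R < D" using rR by (simp add: ennreal_less_iff)
    have "0 < R / D" "R / D \<le> 1" using rR \<open>R < D\<close> by auto
    then obtain W where W: "stopping_set (R / D) W" and cov: "stopping_cover (R / D) W"
      by (rule stopping_words)
    have "E \<subseteq> (\<Union>i\<in>I. \<phi> i ` E) \<union> {}" using E(3) by simp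
    then obtain w where w: "w \<in> W" "x \<in> wmap w ` E" using x by (rule stopping_coverE[OF cov]) auto
    then obtain x' where x': "x' \<in> E" "x = wmap w x'" by auto
    have wl: "w \<in> lists I" "rmin * (R / D) \<le> wratio w" "wratio w \<le> R / D"
      using W w by (auto simp: stopping_set_def)
    have wE: "wmap w ` E \<subseteq> E" using E(3) wl(1) by (intro wmap_image_subset) auto
    \<comment> \<open>The center \<open>y\<close> need not lie in the piece, so a point of the piece
      near \<open>y\<close> is pulled back instead. For balls missing the piece the value of
      \<open>z y\<close> is arbitrary and harmless.\<close>
    define z where "z y = (SOME e. e \<in> E \<and> wmap w e \<in> cball y r)" for y
    have "E \<subseteq> (\<Union>y\<in>z ` F. cball y (A * (r / R)))"
    proof
      fix e assume e: "e \<in> E"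
      have "dist x (wmap w e) = wratio w * dist x' e" using x' wmap_similitude[OF wl(1)] by simp
      also have "\<dots> \<le> R / D * D"
        using wl D[OF x'(1) e] wratio_pos[OF wl(1)] rR \<open>0 < D\<close> by (intro mult_mono) auto
      finally have "wmap w e \<in> cball x R \<inter> E" using \<open>0 < D\<close> wE e by auto
      then obtain y where y: "y \<in> F" "wmap w e \<in> cball y r" using F(2) by blast
      then have "e \<in> E \<and> wmap w e \<in> cball y r" using e by simp
      then have "z y \<in> E \<and> wmap w (z y) \<in> cball y r" unfolding z_def by (rule someI)
      then have "dist (wmap w (z y)) (wmap w e) \<le> 2 * r"
        using y(2) dist_triangle3[of "wmap w (z y)" "wmap w e" y] unfolding mem_cball by linarith
      then have "dist (z y) e \<le> 2 * r / wratio w"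
        using wratio_pos[OF wl(1)] by (simp add: wmap_similitude[OF wl(1)] field_simps)
      also have "\<dots> \<le> 2 * r / (rmin * (R / D))"
        using wl(2) rR rmin(1) \<open>0 < D\<close> wratio_pos[OF wl(1)] by (intro divide_left_mono) auto
      also have "\<dots> = A * (r / R)" by (simp add: A_def)
      finally show "e \<in> (\<Union>y\<in>z ` F. cball y (A * (r / R)))" using y(1) by auto
    qed
    then have "(r / R) powr (- s) \<le> M * real (card (z ` F))"
      using rR F(2) by (intro M(2)) auto
    also have "\<dots> \<le> M * real (card F)"
      using F(2) M(1) by (intro mult_left_mono of_nat_mono card_image_le) auto
    finally show "1 / M * (r / R) powr - s \<le> real (card F)" using M(1) by (simp add: field_simps)
  qed (use s M(1) in auto)
qed

end

subsection \<open>The inhomogeneous self-similar set\<close>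

text \<open>The regularity of \<open>C\<close> enters only as bounds for its Hausdorff measure, with
  \<open>K\<close> above at all radii and \<open>k\<close> below up to \<open>r0\<close>.\<close>

locale inhomogeneous_system = condensation_system I \<phi> \<rho> C U
  for I :: "'i set" and \<phi> :: "'i \<Rightarrow> 'a::euclidean_space \<Rightarrow> 'a" and \<rho> :: "'i \<Rightarrow> real"
    and C U :: "'a set" +
  fixes EC :: "'a set" and s K k r0 :: real
  assumes s_pos: "0 < s" and sum_less_1: "(\<Sum>i\<in>I. \<rho> i powr s) < 1"
    and compact_EC: "compact EC" and EC_eq: "EC = (\<Union>i\<in>I. \<phi> i ` EC) \<union> C"
    and K_pos: "0 < K" and k_pos: "0 < k" and r0_pos: "0 < r0"
    and C_upper: "x \<in> C \<Longrightarrow> 0 < r \<Longrightarrow> hausdorff_measure s (cball x r \<inter> C) \<le> ennreal (K * r powr s)"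
    and C_lower: "x \<in> C \<Longrightarrow> 0 < r \<Longrightarrow> r \<le> r0 \<Longrightarrow>
      ennreal (k * r powr s) \<le> hausdorff_measure s (cball x r \<inter> C)"
begin

sublocale H: metric_outer_measure "hausdorff_measure s :: 'a set \<Rightarrow> ennreal"
  using s_pos by (rule metric_outer_measure_hausdorff)

lemma bounded_EC: "bounded EC"
  using compact_EC by (rule compact_imp_bounded)

lemma C_subset_EC: "C \<subseteq> EC"
  using EC_eq by blast

lemma wmap_EC: "w \<in> lists I \<Longrightarrow> wmap w ` EC \<subseteq> EC"
  using equalityD2[OF EC_eq] by (intro wmap_image_subset) auto

lemma EC_subset_closure_U: "EC \<subseteq> closure U"
  using subset_closure_U[OF bounded_EC equalityD1[OF EC_eq]] C_subset closure_subset by blast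

lemma image_EC_subset: "i \<in> I \<Longrightarrow> \<phi> i ` EC \<subseteq> closure (\<phi> i ` U)"
  using image_mono[OF EC_subset_closure_U, of "\<phi> i"] image_closure_U by (rule order_trans)

lemma wmap_Int_EC:
  assumes "w \<in> lists I" "V \<subseteq> U"
  shows "wmap w ` V \<inter> EC = wmap w ` (V \<inter> EC)"
  using assms(1)
proof (induction w)
  case (Cons i w)
  then have i: "i \<in> I" and w: "w \<in> lists I" by auto
  have sub: "wmap w ` V \<subseteq> U" using wmap_U[OF w] assms(2) by blast
  have "y \<in> \<phi> i ` EC" if y: "y \<in> \<phi> i ` wmap w ` V" "y \<in> EC" for y
  proof -
    have yU: "y \<in> \<phi> i ` U" using y(1) sub by blast
    then have "y \<notin> C" using C_disjoint[OF i] closure_subset[of "\<phi> i ` U"] by blast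
    then obtain j where j: "j \<in> I" "y \<in> \<phi> j ` EC" using y(2) EC_eq by blast
    have "j = i"
    proof (rule ccontr)
      assume "j \<noteq> i"
      then have "\<phi> i ` U \<inter> closure (\<phi> j ` U) = {}"
        using disjoint_U[OF i j(1)] open_image_U[OF i] by (simp add: open_Int_closure_eq_empty)
      then show False using image_EC_subset[OF j(1)] j(2) yU by blast
    qed
    then show ?thesis using j(2) by simp
  qed
  moreover have "\<phi> i ` EC \<subseteq> EC" using EC_eq i by blast
  ultimately have "\<phi> i ` wmap w ` V \<inter> EC = \<phi> i ` wmap w ` V \<inter> \<phi> i ` EC" by blast
  also have "\<dots> = \<phi> i ` (wmap w ` V \<inter> EC)"
    by (rule image_Int[OF similitude_inj[OF \<rho>_pos similitude, OF i i], symmetric])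
  finally show ?case using Cons.IH unfolding wmap_image_Cons by simp
qed simp

text \<open>The open set \<open>Q\<close> contains the compact \<open>C\<close>, whence a uniform
  \<open>\<epsilon>\<close>; since the images of \<open>EC\<close> lie in the removed closures,
  \<open>Q\<close> meets \<open>EC\<close> only in \<open>C\<close>.\<close>

lemma ex_separation:
  obtains \<epsilon> where "0 < \<epsilon>" "\<And>x. x \<in> C \<Longrightarrow> ball x \<epsilon> \<subseteq> U" "\<And>x. x \<in> C \<Longrightarrow> ball x \<epsilon> \<inter> EC \<subseteq> C"
proof -
  define Q where "Q = U - (\<Union>i\<in>I. closure (\<phi> i ` U))"
  have "open Q" unfolding Q_def using open_U finite_I by (intro open_Diff closed_UN) auto
  moreover have "C \<subseteq> Q" unfolding Q_def using C_subset C_disjoint by blast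
  ultimately obtain \<epsilon> where \<epsilon>: "0 < \<epsilon>" "(\<Union>x\<in>C. ball x \<epsilon>) \<subseteq> Q"
    using compact_subset_open_imp_ball_epsilon_subset[OF compact_C] by metis
  have "Q \<inter> EC \<subseteq> C"
  proof
    fix y assume y: "y \<in> Q \<inter> EC"
    then have "y \<in> (\<Union>i\<in>I. \<phi> i ` EC) \<union> C" using EC_eq by simp
    then show "y \<in> C" using y image_EC_subset unfolding Q_def by blast
  qed
  moreover have "ball x \<epsilon> \<subseteq> Q" if "x \<in> C" for x using \<epsilon>(2) that by blast
  moreover have "Q \<subseteq> U" by (auto simp: Q_def)
  ultimately show thesis by (intro that[OF \<epsilon>(1)]) blast+
qed

section \<open>Finiteness and regularity of the Hausdorff measure on \<open>EC\<close>\<close>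

lemma hausdorff_C_pos: "0 < hausdorff_measure s C"
proof -
  obtain x where x: "x \<in> C" using C_nonempty by auto
  have "0 < ennreal (k * r0 powr s)" using k_pos r0_pos by simp
  also have "\<dots> \<le> hausdorff_measure s (cball x r0 \<inter> C)" using C_lower[OF x, of r0] r0_pos by simp
  also have "\<dots> \<le> hausdorff_measure s C" by (rule H.h_mono) auto
  finally show ?thesis .
qed

lemma hausdorff_C_finite: "hausdorff_measure s C < \<infinity>"
proof -
  obtain x where x: "x \<in> C" using C_nonempty by auto
  obtain T where T: "\<And>y. y \<in> C \<Longrightarrow> dist x y \<le> T"
    using compact_imp_bounded[OF compact_C] bounded_any_center by metis
  have "C = cball x (max T 1) \<inter> C" using T by force
  then have "hausdorff_measure s C \<le> ennreal (K * max T 1 powr s)"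
    using C_upper[OF x, of "max T 1"] by simp
  then show ?thesis using ennreal_less_top le_less_trans by fastforce
qed

text \<open>
  At a fixed scale \<open>\<delta>\<close> the premeasure of the compact set \<open>EC\<close> is finite, and \<open>EC_eq\<close> bounds it by
  \<open>\<Lambda>\<close> times itself plus the measure of \<open>C\<close>, where \<open>\<Lambda> < 1\<close>; this can be solved for the premeasure.
\<close>
lemma hausdorff_EC_finite: "hausdorff_measure s EC < \<infinity>"
proof -
  define \<Lambda> where "\<Lambda> = (\<Sum>i\<in>I. \<rho> i powr s)"
  have \<Lambda>: "0 \<le> \<Lambda>" "\<Lambda> < 1" unfolding \<Lambda>_def using sum_less_1 by (auto intro: sum_nonneg)
  obtain c where c: "hausdorff_measure s C = ennreal c" "0 \<le> c"
    using hausdorff_C_finite by (cases "hausdorff_measure s C" rule: ennreal_cases) auto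
  have pre: "hausdorff_pre s \<delta> EC \<le> ennreal (c / (1 - \<Lambda>))" if \<delta>: "0 < \<delta>" for \<delta>
  proof -
    have "0 < \<delta> / 2" using \<delta> by simp
    then obtain F where F: "finite F" "EC \<subseteq> (\<Union>x\<in>F. ball x (\<delta> / 2))"
      using seq_compact_imp_totally_bounded[OF compact_imp_seq_compact[OF compact_EC]] by metis
    have "diameter (ball x (\<delta> / 2)) \<le> \<delta>" for x :: 'a using \<delta> by simp
    then have "hausdorff_pre s \<delta> EC \<le> (\<Sum>x\<in>F. ennreal (diameter (ball x (\<delta> / 2)) powr s))"
      using F \<delta> by (intro hausdorff_pre_finite_cover) auto
    also have "\<dots> < top" using F(1) by (subst ennreal_sum_less_top) auto
    finally obtain p where p: "hausdorff_pre s \<delta> EC = ennreal p" "0 \<le> p"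
      by (cases "hausdorff_pre s \<delta> EC" rule: ennreal_cases) auto
    have piece: "hausdorff_pre s \<delta> (\<phi> i ` EC) \<le> ennreal (\<rho> i powr s * p)" if i: "i \<in> I" for i
    proof -
      \<comment> \<open>The map \<open>\<phi> i\<close> turns covers at scale
        \<open>\<delta>\<close> into covers at the finer scale \<open>\<rho> i * \<delta>\<close>,
        where the premeasure can only be larger.\<close>
      have "hausdorff_pre s \<delta> (\<phi> i ` EC) \<le> hausdorff_pre s (\<rho> i * \<delta>) (\<phi> i ` EC)"
        using \<rho>_less_1[OF i] \<delta> by (intro hausdorff_pre_antimono) simp
      also have "\<dots> \<le> ennreal (\<rho> i powr s) * hausdorff_pre s \<delta> EC"
        using s_pos i by (intro hausdorff_pre_lipschitz_image \<rho>_pos) (auto simp: similitude)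
      finally show ?thesis using p by (simp add: ennreal_mult)
    qed
    define A where "A j = (case j of None \<Rightarrow> C | Some i \<Rightarrow> \<phi> i ` EC)" for j
    have "EC = (\<Union>j\<in>insert None (Some ` I). A j)"
      using EC_eq unfolding A_def by auto
    then have "hausdorff_pre s \<delta> EC \<le> (\<Sum>j\<in>insert None (Some ` I). hausdorff_pre s \<delta> (A j))"
      using finite_I \<delta> finite_subadditive_of_countable[of "hausdorff_pre s \<delta>" UNIV "insert None (Some ` I)" A]
      by (simp add: hausdorff_pre_UN hausdorff_pre_empty)
    also have "\<dots> = hausdorff_pre s \<delta> C + (\<Sum>i\<in>I. hausdorff_pre s \<delta> (\<phi> i ` EC))"
      using finite_I by (subst sum.insert) (auto simp: A_def sum.reindex)
    also have "\<dots> \<le> ennreal c + (\<Sum>i\<in>I. ennreal (\<rho> i powr s * p))"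
      using hausdorff_pre_le_measure[OF \<delta>, of s C] c piece by (intro add_mono sum_mono) auto
    also have "\<dots> = ennreal (c + \<Lambda> * p)"
      using p c by (subst sum_ennreal) (auto simp: \<Lambda>_def sum_distrib_right sum_nonneg)
    finally have "ennreal p \<le> ennreal (c + \<Lambda> * p)" unfolding p(1) .
    then have "p \<le> c + \<Lambda> * p" using p c \<Lambda> by (subst (asm) ennreal_le_iff) auto
    then show ?thesis using p \<Lambda> by (auto simp: field_simps intro!: ennreal_leI)
  qed
  have "hausdorff_measure s EC \<le> ennreal (c / (1 - \<Lambda>))"
    by (rule hausdorff_measure_le[OF zero_less_one]) (rule pre)
  then show ?thesis using ennreal_less_top le_less_trans by fastforce
qed

text \<open>
  Either the ball meets a copy of \<open>C\<close> so large that no other copy is within reach, or it is covered by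
  boundedly many copies of \<open>EC\<close> whose size is comparable to the radius.
\<close>
lemma ex_upper_bound:
  obtains K' where "0 < K'"
    "\<And>x r. 0 < r \<Longrightarrow> hausdorff_measure s (cball x r \<inter> EC) \<le> ennreal (K' * r powr s)"
proof -
  obtain \<epsilon> where \<epsilon>: "0 < \<epsilon>" "\<And>x. x \<in> C \<Longrightarrow> ball x \<epsilon> \<subseteq> U" "\<And>x. x \<in> C \<Longrightarrow> ball x \<epsilon> \<inter> EC \<subseteq> C"
    by (rule ex_separation) blast
  have "0 < \<epsilon> / 2" using \<epsilon>(1) by simp
  from stopping_set_count[OF this] obtain M where M: "0 < M"
    "\<And>\<delta> W x. 0 < \<delta> \<Longrightarrow> stopping_set \<delta> W \<Longrightarrow>
      real (card {w\<in>W. wmap w ` closure U \<inter> cball x (\<epsilon> / 2 * \<delta>) \<noteq> {}}) \<le> M"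
    by blast
  obtain h where h: "hausdorff_measure s EC = ennreal h" "0 \<le> h"
    using hausdorff_EC_finite by (cases "hausdorff_measure s EC" rule: ennreal_cases) auto
  define K1 where "K1 = K * 2 powr s"
  \<comment> \<open>The summand \<open>1\<close> lets the same constant handle
    \<open>\<delta> \<ge> 1\<close>, where the total mass \<open>h\<close> is the bound.\<close>
  define K2 where "K2 = (M + 1) * h * (2 / \<epsilon>) powr s"
  have K12: "0 < K1" "0 \<le> K2" using K_pos M h by (auto simp: K1_def K2_def)
  show thesis
  proof (rule that[of "K1 + K2"])
    fix x and r :: real assume r: "0 < r"
    \<comment> \<open>A ratio \<open>q\<close> above \<open>\<delta>\<close> means
      \<open>2 * r < q * \<epsilon>\<close>: a ball meeting that copy of \<open>C\<close> lies in
      its separating neighbourhood. For ratios up to \<open>\<delta>\<close>, the count with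
      \<open>A = \<epsilon> / 2\<close> refers exactly to the radius \<open>r\<close>.\<close>
    define \<delta> where "\<delta> = 2 * r / \<epsilon>"
    have \<delta>: "0 < \<delta>" using r \<epsilon> by (simp add: \<delta>_def)
    have \<delta>s: "\<delta> powr s = (2 / \<epsilon>) powr s * r powr s"
      using r \<epsilon>(1) by (simp add: \<delta>_def powr_mult powr_divide)
    have "hausdorff_measure s (cball x r \<inter> EC) \<le> ennreal (K1 * r powr s) \<or>
      hausdorff_measure s (cball x r \<inter> EC) \<le> ennreal (K2 * r powr s)"
    proof (cases "\<exists>w\<in>lists I. \<delta> < wratio w \<and> wmap w ` C \<inter> cball x r \<noteq> {}")
      case True
      then obtain w y where w: "w \<in> lists I" "\<delta> < wratio w" and y: "y \<in> C" "wmap w y \<in> cball x r"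
        by blast
      define q where "q = wratio w"
      have q: "0 < q" "2 * r < q * \<epsilon>"
        using wratio_pos[OF w(1)] w(2) \<epsilon>(1) by (auto simp: q_def \<delta>_def field_simps)
      \<comment> \<open>Everything in the ball is within \<open>2 * r\<close> of a point of the
        copy, hence in the image of \<open>ball y \<epsilon>\<close>, where \<open>EC\<close>
        reduces to the copy of \<open>C\<close>.\<close>
      have "cball x r \<inter> EC \<subseteq> wmap w ` (cball y (2 * r / q) \<inter> C)"
      proof
        fix z assume z: "z \<in> cball x r \<inter> EC"
        have d: "dist (wmap w y) z \<le> 2 * r"
          using z y(2) dist_triangle3[of "wmap w y" z x] by simp
        then have "z \<in> ball (wmap w y) (q * \<epsilon>)" using q by simp
        also have "\<dots> = wmap w ` ball y \<epsilon>"
          using similitude_image_ball[OF wratio_pos wmap_similitude, OF w(1) w(1)] by (simp add: q_def)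
        finally have "z \<in> wmap w ` ball y \<epsilon> \<inter> EC" using z by simp
        then obtain z' where z': "z' \<in> ball y \<epsilon> \<inter> EC" "z = wmap w z'"
          unfolding wmap_Int_EC[OF w(1) \<epsilon>(2)[OF y(1)]] by blast
        then have "q * dist y z' \<le> 2 * r" using d wmap_similitude[OF w(1)] by (simp add: q_def)
        then have "dist y z' \<le> 2 * r / q" using q by (simp add: field_simps)
        then show "z \<in> wmap w ` (cball y (2 * r / q) \<inter> C)" using z' \<epsilon>(3)[OF y(1)] by auto
      qed
      then have "hausdorff_measure s (cball x r \<inter> EC)
          \<le> hausdorff_measure s (wmap w ` (cball y (2 * r / q) \<inter> C))" by (rule H.h_mono)
      also have "\<dots> = ennreal (q powr s) * hausdorff_measure s (cball y (2 * r / q) \<inter> C)"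
        unfolding q_def by (rule hausdorff_measure_wmap[OF s_pos w(1)])
      also have "\<dots> \<le> ennreal (q powr s) * ennreal (K * (2 * r / q) powr s)"
        using C_upper[OF y(1)] r q by (intro mult_left_mono) auto
      also have "\<dots> = ennreal (q powr s * (K * (2 * r / q) powr s))"
        using K_pos by (simp add: ennreal_mult)
      also have "q powr s * (K * (2 * r / q) powr s) = K1 * r powr s"
        using q r by (simp add: K1_def powr_mult powr_divide)
      finally show ?thesis by blast
    next
      case False
      show ?thesis
      proof (cases "1 \<le> \<delta>")
        case True
        have "hausdorff_measure s (cball x r \<inter> EC) \<le> ennreal h"
          unfolding h(1)[symmetric] by (rule H.h_mono) auto
        also have "\<dots> \<le> ennreal (K2 * r powr s)"
        proof (rule ennreal_leI)
          have "1 \<le> \<delta> powr s" using True s_pos by (simp add: ge_one_powr_ge_zero)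
          then have "1 * h * 1 \<le> (M + 1) * h * \<delta> powr s" using M(1) h(2) by (intro mult_mono) auto
          then show "h \<le> K2 * r powr s" by (simp add: K2_def \<delta>s mult.assoc)
        qed
        finally show ?thesis by blast
      next
        case small: False
        then obtain W where W: "stopping_set \<delta> W" and cov: "stopping_cover \<delta> W"
          using stopping_words[OF \<delta>] by force
        let ?F = "{w\<in>W. wmap w ` closure U \<inter> cball x (\<epsilon> / 2 * \<delta>) \<noteq> {}}"
        have "\<epsilon> / 2 * \<delta> = r" using \<epsilon>(1) by (simp add: \<delta>_def)
        have F: "finite ?F" "\<And>w. w \<in> ?F \<Longrightarrow> w \<in> lists I" "\<And>w. w \<in> ?F \<Longrightarrow> wratio w \<le> \<delta>"
          using W by (auto simp: stopping_set_def)
        have "cball x r \<inter> EC \<subseteq> (\<Union>w\<in>?F. wmap w ` EC)"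
        proof
          fix z assume z: "z \<in> cball x r \<inter> EC"
          have "z \<in> EC" using z by simp
          with cov EC_eq[THEN equalityD1] show "z \<in> (\<Union>w\<in>?F. wmap w ` EC)"
          proof (rule stopping_coverE)
            fix w assume w: "w \<in> W" "z \<in> wmap w ` EC"
            then have "z \<in> wmap w ` closure U" using EC_subset_closure_U by blast
            then have "w \<in> ?F" unfolding \<open>\<epsilon> / 2 * \<delta> = r\<close> using w(1) z by blast
            then show ?thesis using w(2) by (rule UN_I)
          next
            fix w assume w: "w \<in> lists I" "\<delta> < wratio w" "z \<in> wmap w ` C"
            then have "z \<in> wmap w ` C \<inter> cball x r" using z by simp
            then have "wmap w ` C \<inter> cball x r \<noteq> {}" by auto
            then show ?thesis using False w(1,2) by metis
          qed
        qed
        then have "hausdorff_measure s (cball x r \<inter> EC) \<le> hausdorff_measure s (\<Union>w\<in>?F. wmap w ` EC)"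
          by (rule H.h_mono)
        also have "\<dots> \<le> (\<Sum>w\<in>?F. hausdorff_measure s (wmap w ` EC))"
          by (rule H.h_finite_UN[OF F(1)])
        also have "\<dots> \<le> (\<Sum>w\<in>?F. ennreal (\<delta> powr s * h))"
        proof (rule sum_mono)
          fix w assume w: "w \<in> ?F"
          have "hausdorff_measure s (wmap w ` EC) = ennreal (wratio w powr s) * ennreal h"
            using hausdorff_measure_wmap[OF s_pos F(2)[OF w]] h by simp
          also have "\<dots> = ennreal (wratio w powr s * h)" using h by (simp add: ennreal_mult)
          also have "\<dots> \<le> ennreal (\<delta> powr s * h)"
            using F(3)[OF w] wratio_pos[OF F(2)[OF w]] s_pos h
            by (intro ennreal_leI mult_right_mono powr_mono2) auto
          finally show "hausdorff_measure s (wmap w ` EC) \<le> ennreal (\<delta> powr s * h)" .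
        qed
        also have "\<dots> = ennreal (real (card ?F) * (\<delta> powr s * h))"
          using h by (subst sum_ennreal) auto
        also have "\<dots> \<le> ennreal (K2 * r powr s)"
        proof (rule ennreal_leI)
          have "real (card ?F) * (\<delta> powr s * h) \<le> (M + 1) * (\<delta> powr s * h)"
            using M(2)[OF \<delta> W, of x] h by (intro mult_right_mono) auto
          then show "real (card ?F) * (\<delta> powr s * h) \<le> K2 * r powr s"
            by (simp add: K2_def \<delta>s ac_simps)
        qed
        finally show ?thesis by blast
      qed
    qed
    moreover have "ennreal (K1 * r powr s) \<le> ennreal ((K1 + K2) * r powr s)"
      "ennreal (K2 * r powr s) \<le> ennreal ((K1 + K2) * r powr s)"
      using K12 by (auto intro!: ennreal_leI mult_right_mono)
    ultimately show "hausdorff_measure s (cball x r \<inter> EC) \<le> ennreal ((K1 + K2) * r powr s)"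
      using order_trans by blast
  qed (use K12 in simp)
qed

text \<open>Words are stopped at \<open>r / D\<close>. If \<open>x\<close> lies in a stopped piece,
  that piece fits into the ball and its copy of \<open>C\<close> provides the mass. Otherwise
  \<open>x\<close> lies in a copy of \<open>C\<close> with ratio above \<open>r / D\<close>, and the
  bound for \<open>C\<close> is transported by the word map.\<close>

lemma ex_lower_bound:
  assumes "0 < D" and D: "\<And>x y. x \<in> EC \<Longrightarrow> y \<in> EC \<Longrightarrow> dist x y \<le> D"
  obtains k' where "0 < k'"
    "\<And>x r. x \<in> EC \<Longrightarrow> 0 < r \<Longrightarrow> r \<le> D \<Longrightarrow> ennreal (k' * r powr s) \<le> hausdorff_measure s (cball x r \<inter> EC)"
proof -
  obtain c where c: "hausdorff_measure s C = ennreal c" "0 < c"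
    using hausdorff_C_finite hausdorff_C_pos by (cases "hausdorff_measure s C" rule: ennreal_cases) auto
  \<comment> \<open>Pulled back to \<open>C\<close>, the radius \<open>r / q\<close> may come close
    to \<open>D\<close>, whereas the bound for \<open>C\<close> is valid up to \<open>r0\<close>.
    Shrinking by \<open>m\<close> repairs this and puts the factor \<open>m powr s\<close> into
    \<open>k2\<close>.\<close>
  define m where "m = min 1 (r0 / D)"
  have m: "0 < m" "m \<le> 1" "m * D \<le> r0"
    using r0_pos \<open>0 < D\<close> by (auto simp: m_def min_def field_simps)
  define k1 where "k1 = (rmin / D) powr s * c"
  define k2 where "k2 = k * m powr s"
  have k12: "0 < k1" "0 < k2" using rmin(1) \<open>0 < D\<close> c k_pos m by (auto simp: k1_def k2_def)
  show thesis
  proof (rule that[of "min k1 k2"])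
    fix x r assume x: "x \<in> EC" and r: "0 < r" "r \<le> D"
    have "0 < r / D" "r / D \<le> 1" using r by auto
    then obtain W where W: "stopping_set (r / D) W" and cov: "stopping_cover (r / D) W"
      by (rule stopping_words)
    have "ennreal (k1 * r powr s) \<le> hausdorff_measure s (cball x r \<inter> EC) \<or>
      ennreal (k2 * r powr s) \<le> hausdorff_measure s (cball x r \<inter> EC)"
      using cov EC_eq[THEN equalityD1] x
    proof (rule stopping_coverE)
      fix w assume w: "w \<in> W" "x \<in> wmap w ` EC"
      have wl: "w \<in> lists I" "rmin * (r / D) \<le> wratio w" "wratio w \<le> r / D"
        using W w by (auto simp: stopping_set_def)
      obtain x' where x': "x' \<in> EC" "x = wmap w x'" using w by blast
      have "wmap w ` C \<subseteq> cball x r \<inter> EC"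
      proof
        fix z assume "z \<in> wmap w ` C"
        then obtain z' where z': "z' \<in> EC" "z = wmap w z'" using C_subset_EC by blast
        have "dist x z = wratio w * dist x' z'" using x' z' wmap_similitude[OF wl(1)] by simp
        also have "\<dots> \<le> r / D * D"
          using wl D[OF x'(1) z'(1)] r wratio_pos[OF wl(1)] \<open>0 < D\<close> by (intro mult_mono) auto
        finally show "z \<in> cball x r \<inter> EC" using \<open>0 < D\<close> z' wmap_EC[OF wl(1)] by auto
      qed
      then have "hausdorff_measure s (wmap w ` C) \<le> hausdorff_measure s (cball x r \<inter> EC)"
        by (rule H.h_mono)
      moreover have "hausdorff_measure s (wmap w ` C) = ennreal (wratio w powr s * c)"
        using hausdorff_measure_wmap[OF s_pos wl(1), of C] c by (simp add: ennreal_mult)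
      moreover have "ennreal (k1 * r powr s) \<le> ennreal (wratio w powr s * c)"
      proof (rule ennreal_leI)
        have "(rmin * (r / D)) powr s \<le> wratio w powr s"
          using wl(2) rmin(1) r \<open>0 < D\<close> s_pos by (intro powr_mono2) auto
        moreover have "(rmin * (r / D)) powr s = (rmin / D) powr s * r powr s"
          using rmin(1) r \<open>0 < D\<close> by (simp add: powr_mult powr_divide)
        ultimately show "k1 * r powr s \<le> wratio w powr s * c"
          using c(2) by (simp add: k1_def mult_right_mono mult.commute mult.left_commute)
      qed
      ultimately show ?thesis by auto
    next
      fix w assume w: "w \<in> lists I" "r / D < wratio w" "x \<in> wmap w ` C"
      obtain x' where x': "x' \<in> C" "x = wmap w x'" using w(3) by blast
      define q where "q = wratio w"
      have q: "0 < q" "r < q * D" using wratio_pos[OF w(1)] w(2) \<open>0 < D\<close> by (auto simp: q_def field_simps)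
      define r' where "r' = m * (r / q)"
      have "r / q \<le> D" using q by (simp add: field_simps)
      then have "m * (r / q) \<le> m * D" using m by (intro mult_left_mono) auto
      then have r': "0 < r'" "r' \<le> r0" using m q r by (auto simp: r'_def)
      have "q * r' \<le> r" using m q r by (simp add: r'_def mult_left_le_one_le)
      have "wmap w ` (cball x' r' \<inter> C) \<subseteq> cball x r \<inter> EC"
      proof
        fix z assume "z \<in> wmap w ` (cball x' r' \<inter> C)"
        then obtain z' where z': "z' \<in> C" "dist x' z' \<le> r'" "z = wmap w z'" by auto
        have "dist x z = q * dist x' z'" using x' z' wmap_similitude[OF w(1)] by (simp add: q_def)
        also have "\<dots> \<le> q * r'" using z' q by simp
        finally show "z \<in> cball x r \<inter> EC"
          using \<open>q * r' \<le> r\<close> z' wmap_EC[OF w(1)] C_subset_EC by auto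
      qed
      then have "hausdorff_measure s (wmap w ` (cball x' r' \<inter> C)) \<le> hausdorff_measure s (cball x r \<inter> EC)"
        by (rule H.h_mono)
      moreover have "ennreal (q powr s) * ennreal (k * r' powr s)
          \<le> hausdorff_measure s (wmap w ` (cball x' r' \<inter> C))"
        unfolding hausdorff_measure_wmap[OF s_pos w(1)] q_def[symmetric]
        using C_lower[OF x'(1) r'] by (intro mult_left_mono) auto
      moreover have "ennreal (q powr s) * ennreal (k * r' powr s) = ennreal (k2 * r powr s)"
      proof -
        have "q powr s * (k * r' powr s) = k2 * r powr s"
          using q m r by (simp add: r'_def k2_def powr_mult powr_divide)
        then show ?thesis using k_pos by (simp flip: ennreal_mult)
      qed
      ultimately show ?thesis by auto
    qed
    moreover have "ennreal (min k1 k2 * r powr s) \<le> ennreal (k1 * r powr s)"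
      "ennreal (min k1 k2 * r powr s) \<le> ennreal (k2 * r powr s)"
      by (auto intro!: ennreal_leI mult_right_mono)
    ultimately show "ennreal (min k1 k2 * r powr s) \<le> hausdorff_measure s (cball x r \<inter> EC)"
      using order_trans by blast
  qed (use k12 in simp)
qed

lemma bounded_ahlfors_regular_EC:
  assumes "a \<in> EC" "b \<in> EC" "a \<noteq> b"
  obtains c D where "bounded_ahlfors_regular s c D EC (\<lambda>A. hausdorff_measure s (A \<inter> EC))"
proof -
  define D where "D = diameter EC"
  have D: "dist x y \<le> D" if "x \<in> EC" "y \<in> EC" for x y
    unfolding D_def using that bounded_EC by (intro diameter_bounded_bound)
  have "0 < D" using D[OF assms(1,2)] assms(3) by (meson less_le_trans zero_less_dist_iff)
  obtain K' where K': "0 < K'"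
    "\<And>x r. 0 < r \<Longrightarrow> hausdorff_measure s (cball x r \<inter> EC) \<le> ennreal (K' * r powr s)"
    by (rule ex_upper_bound) blast
  obtain k' where k': "0 < k'" "\<And>x r. x \<in> EC \<Longrightarrow> 0 < r \<Longrightarrow> r \<le> D \<Longrightarrow>
      ennreal (k' * r powr s) \<le> hausdorff_measure s (cball x r \<inter> EC)"
    using ex_lower_bound[OF \<open>0 < D\<close> D] by metis
  define c where "c = max 1 (max K' (1 / k'))"
  have c: "1 \<le> c" "K' \<le> c" "1 / k' \<le> c" by (auto simp: c_def)
  have "bounded_ahlfors_regular s c D EC (\<lambda>A. hausdorff_measure s (A \<inter> EC))"
  proof
    have "hausdorff_measure s C \<le> hausdorff_measure s EC" using C_subset_EC by (rule H.h_mono)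
    then have "hausdorff_measure s EC \<noteq> 0" using hausdorff_C_pos by auto
    then show "metric_measure EC (\<lambda>A. hausdorff_measure s (A \<inter> EC))"
      using hausdorff_EC_finite by (intro H.metric_measure_restrict hausdorff_measure_borel_regular[OF s_pos])
    show "ediam EC \<le> ennreal D"
      unfolding ediam_def by (rule SUP_least) (auto intro!: ennreal_leI D)
    show "\<exists>a\<in>EC. \<exists>b\<in>EC. a \<noteq> b" using assms by blast
    fix x and r :: real assume x: "x \<in> EC" and r: "0 < r"
    have "ennreal (K' * r powr s) \<le> ennreal (c * r powr s)"
      using c by (intro ennreal_leI mult_right_mono) auto
    then show "hausdorff_measure s (cball x r \<inter> EC \<inter> EC) \<le> ennreal (c * r powr s)"
      using K'(2)[OF r, of x] by (simp add: Int_assoc)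
    assume "r \<le> D"
    have "1 / c \<le> k'" using c k'(1) by (simp add: field_simps)
    then have "ennreal (r powr s / c) \<le> ennreal (k' * r powr s)"
      using mult_right_mono[of "1 / c" k' "r powr s"] by (intro ennreal_leI) simp
    then show "ennreal (r powr s / c) \<le> hausdorff_measure s (cball x r \<inter> EC \<inter> EC)"
      using k'(2)[OF x r \<open>r \<le> D\<close>] by (simp add: Int_assoc)
  qed (use s_pos c \<open>0 < D\<close> in auto)
  then show thesis by (rule that)
qed

end

section \<open>Reduction to a bounded open set, and conclusion\<close>

lemma condensation_open_set_bounded:
  fixes \<phi> :: "nat \<Rightarrow> 'a::euclidean_space \<Rightarrow> 'a"
  assumes cosc: "condensation_open_set_condition \<kappa> \<phi> C" and "bounded C"
    and \<rho>: "\<And>i. i \<in> {1..\<kappa>} \<Longrightarrow> 0 < \<rho> i \<and> \<rho> i < 1"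
    and sim: "\<And>i x y. i \<in> {1..\<kappa>} \<Longrightarrow> dist (\<phi> i x) (\<phi> i y) = \<rho> i * dist x y"
  obtains U where "open U" "bounded U" "C \<subseteq> U" "\<And>i. i \<in> {1..\<kappa>} \<Longrightarrow> C \<inter> closure (\<phi> i ` U) = {}"
    "\<And>i. i \<in> {1..\<kappa>} \<Longrightarrow> \<phi> i ` U \<subseteq> U"
    "\<And>i j. i \<in> {1..\<kappa>} \<Longrightarrow> j \<in> {1..\<kappa>} \<Longrightarrow> i \<noteq> j \<Longrightarrow> \<phi> i ` U \<inter> \<phi> j ` U = {}"
proof -
  obtain U where U: "open U" "C \<subseteq> U - (\<Union>i\<in>{1..\<kappa>}. closure (\<phi> i ` U))"
      "\<forall>i\<in>{1..\<kappa>}. \<phi> i ` U \<subseteq> U"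
      "\<forall>i\<in>{1..\<kappa>}. \<forall>j\<in>{1..\<kappa>}. i \<noteq> j \<longrightarrow> \<phi> i ` U \<inter> \<phi> j ` U = {}"
    using cosc unfolding condensation_open_set_condition_def by (elim exE conjE) (rule that)
  obtain T0 where T0: "\<And>x. x \<in> C \<Longrightarrow> dist 0 x < T0"
    using \<open>bounded C\<close> by (metis bounded_subset_ballD mem_ball subsetD)
  \<comment> \<open>The map \<open>\<phi> i\<close> sends \<open>ball 0 T\<close> into itself once
    \<open>norm (\<phi> i 0) \<le> T * (1 - \<rho> i)\<close>; the sum dominates all these quotients
    at once, and \<open>T0\<close> makes room for \<open>C\<close>. Intersecting \<open>U\<close>
    with this ball preserves every clause of the condition.\<close>
  define T where "T = max T0 0 + (\<Sum>i\<in>{1..\<kappa>}. norm (\<phi> i 0) / (1 - \<rho> i)) + 1"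
  have nonneg: "0 \<le> norm (\<phi> i 0) / (1 - \<rho> i)" if "i \<in> {1..\<kappa>}" for i using \<rho>[OF that] by simp
  have ball: "\<phi> i ` ball 0 T \<subseteq> ball 0 T" if i: "i \<in> {1..\<kappa>}" for i
  proof
    fix y assume "y \<in> \<phi> i ` ball 0 T"
    then obtain x where x: "dist 0 x < T" "y = \<phi> i x" by auto
    have "norm (\<phi> i 0) / (1 - \<rho> i) \<le> (\<Sum>i\<in>{1..\<kappa>}. norm (\<phi> i 0) / (1 - \<rho> i))"
      using i nonneg by (intro member_le_sum) auto
    then have "norm (\<phi> i 0) / (1 - \<rho> i) \<le> T" by (simp add: T_def)
    then have *: "norm (\<phi> i 0) \<le> T * (1 - \<rho> i)" using \<rho>[OF i] by (simp add: field_simps)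
    have "dist 0 y \<le> norm (\<phi> i 0) + \<rho> i * dist 0 x"
      using dist_triangle[of 0 y "\<phi> i 0"] sim[OF i, of 0 x] x by simp
    also have "\<dots> < T * (1 - \<rho> i) + \<rho> i * T" using * x \<rho>[OF i] by (intro add_le_less_mono) auto
    finally show "y \<in> ball 0 T" by (simp add: algebra_simps)
  qed
  show thesis
  proof (rule that[of "U \<inter> ball 0 T"])
    have "0 \<le> (\<Sum>i\<in>{1..\<kappa>}. norm (\<phi> i 0) / (1 - \<rho> i))" using nonneg by (rule sum_nonneg)
    then have "dist 0 x < T" if "x \<in> C" for x using T0[OF that] by (simp add: T_def)
    then show "C \<subseteq> U \<inter> ball 0 T" using U(2) by auto
    show "C \<inter> closure (\<phi> i ` (U \<inter> ball 0 T)) = {}" if "i \<in> {1..\<kappa>}" for i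
      using closure_mono[of "\<phi> i ` (U \<inter> ball 0 T)" "\<phi> i ` U"] U(2) that by blast
    show "\<phi> i ` (U \<inter> ball 0 T) \<subseteq> U \<inter> ball 0 T" if "i \<in> {1..\<kappa>}" for i
      using bspec[OF U(3) that] ball[OF that] by blast
    show "\<phi> i ` (U \<inter> ball 0 T) \<inter> \<phi> j ` (U \<inter> ball 0 T) = {}"
      if "i \<in> {1..\<kappa>}" "j \<in> {1..\<kappa>}" "i \<noteq> j" for i j
      using U(4)[rule_format, OF that] by blast
  qed (use U(1) in auto)
qed

theorem proposition5p3:
  fixes s :: real
    and \<kappa> :: nat
    and \<phi> :: "nat \<Rightarrow> real ^ 'd \<Rightarrow> real ^ 'd"
    and C E EC :: "(real ^ 'd) set"
    and \<mu> :: "(real ^ 'd) set \<Rightarrow> ennreal"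
  assumes "s > 0"
    and "compact C"
    and "s_regular s C"
    and "similitude_ifs \<kappa> \<phi>"
    and "condensation_open_set_condition \<kappa> \<phi> C"
    and "self_similar_set \<kappa> \<phi> E"
    and "inhomogeneous_self_similar_set \<kappa> \<phi> C EC"
    and "lower_dim E < ereal s"
    and "\<mu> = (\<lambda>A. hausdorff_measure s (A \<inter> EC))"
  shows "metric_measure EC \<mu> \<and> lower_reg_dim EC \<mu> = ereal s \<and> ereal s = lower_dim EC"
proof -
  obtain \<rho> where \<rho>: "\<And>i. i \<in> {1..\<kappa>} \<Longrightarrow> 0 < \<rho> i \<and> \<rho> i < 1"
    and sim: "\<And>i x y. i \<in> {1..\<kappa>} \<Longrightarrow> dist (\<phi> i x) (\<phi> i y) = \<rho> i * dist x y"
    using assms(4) unfolding similitude_ifs_def contractive_similitude_def by metis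
  have "1 \<le> \<kappa>" using assms(4) by (simp add: similitude_ifs_def)
  obtain a b where ab: "a \<in> C" "b \<in> C" "a \<noteq> b" using assms(3) unfolding s_regular_def by blast
  have "bounded C" using \<open>compact C\<close> by (rule compact_imp_bounded)
  obtain U where U: "open U" "bounded U" "C \<subseteq> U" "\<And>i. i \<in> {1..\<kappa>} \<Longrightarrow> C \<inter> closure (\<phi> i ` U) = {}"
    "\<And>i. i \<in> {1..\<kappa>} \<Longrightarrow> \<phi> i ` U \<subseteq> U"
    "\<And>i j. i \<in> {1..\<kappa>} \<Longrightarrow> j \<in> {1..\<kappa>} \<Longrightarrow> i \<noteq> j \<Longrightarrow> \<phi> i ` U \<inter> \<phi> j ` U = {}"
    using condensation_open_set_bounded[OF assms(5) \<open>bounded C\<close> \<rho> sim] by blast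
  interpret condensation_system "{1..\<kappa>}" \<phi> \<rho> C U
    using \<rho> sim U \<open>1 \<le> \<kappa>\<close> \<open>compact C\<close> ab by unfold_locales auto
  note E = assms(6)[unfolded self_similar_set_def, THEN conjunct1]
    assms(6)[unfolded self_similar_set_def, THEN conjunct2, THEN conjunct1]
    assms(6)[unfolded self_similar_set_def, THEN conjunct2, THEN conjunct2]
  note EC = assms(7)[unfolded inhomogeneous_self_similar_set_def, THEN conjunct2, THEN conjunct1]
    assms(7)[unfolded inhomogeneous_self_similar_set_def, THEN conjunct2, THEN conjunct2]
  have "(\<Sum>i\<in>{1..\<kappa>}. \<rho> i powr s) < 1"
    using lower_dim_attractor_ge[OF E(2,1,3) \<open>s > 0\<close>] assms(8) by force
  moreover obtain \<nu> c D where "ahlfors_regular s c D C \<nu>"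
    using s_regular_imp_ahlfors_regular[OF assms(3) \<open>bounded C\<close>] .
  then interpret C: ahlfors_regular s c D C \<nu> .
  \<comment> \<open>The constants are those with which \<open>C.hausdorff_measure_upper\<close> and
    \<open>C.hausdorff_measure_lower\<close> transfer the regularity of \<open>\<nu>\<close> to the
    Hausdorff measure on \<open>C\<close>.\<close>
  interpret inhomogeneous_system "{1..\<kappa>}" \<phi> \<rho> C U EC s "c\<^sup>2 * 8 powr s" "1 / c\<^sup>2" D
  proof
    show "compact EC" "EC = (\<Union>i\<in>{1..\<kappa>}. \<phi> i ` EC) \<union> C"
      by (fact EC)+
    fix x and r :: real assume "x \<in> C" "0 < r"
    then show "hausdorff_measure s (cball x r \<inter> C) \<le> ennreal (c\<^sup>2 * 8 powr s * r powr s)"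
      by (rule C.hausdorff_measure_upper)
    assume "r \<le> D"
    then show "ennreal (1 / c\<^sup>2 * r powr s) \<le> hausdorff_measure s (cball x r \<inter> C)"
      using C.hausdorff_measure_lower[OF \<open>x \<in> C\<close> \<open>0 < r\<close>] by simp
  qed (use \<open>s > 0\<close> C.c_ge_1 C.D_pos calculation in auto)
  obtain c' D' where "bounded_ahlfors_regular s c' D' EC (\<lambda>A. hausdorff_measure s (A \<inter> EC))"
    using bounded_ahlfors_regular_EC[of a b] ab C_subset_EC by blast
  then interpret R: bounded_ahlfors_regular s c' D' EC \<mu>
    unfolding assms(9) .
  show ?thesis using R.measure R.lower_reg_dim_eq R.lower_dim_eq by simp
qed

end
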